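(* Let $n\ge2$, let $s\in(0,1)$ and $C(s)\ge1$, and let $G$ be a proper subdomain of $\mathbb{R}^n$ such that every positive harmonic function on $G$ satisfies the $(s,C(s))$-Harnack inequality in $G$. (i) For all $x,y\in G$, $$h_G(x,y)\le\left(1+\frac{k_G(x,y)}{2\log(1+s)}\right)\log C(s).$$ (ii) If $G=\mathbb{B}^n$ or $G=\mathbb{H}^n$, then for all $x,y\in G$, $$h_G(x,y)\le\left(1+\frac{\rho_G(x,y)}{\log[(1+s)/(1-s)]}\right)\log C(s).$$
   Context: $\mathbb{B}^n$ is the open unit ball of $\mathbb{R}^n$ and $\mathbb{H}^n=\{x\in\mathbb{R}^n:x_n>0\}$. $d_G(x)$ is the Euclidean distance from $x\in G$ to $\partial G$. A continuous function $u:G\to[0,\infty)$ satisfies the $(s,C(s))$-Harnack inequality in $G$ if $\max_{B_x}u\le C(s)\min_{B_x}u$ whenever $B^n(x,r)\subset G$ and $B_x=\overline{B}^n(x,sr)$, where $B^n(x,r)$ and $\overline{B}^n(x,r)$ are the open and closed Euclidean balls. Harnack metric: $h_G(x,y)=\sup\left|\log\frac{u(x)}{u(y)}\right|$, the supremum being over all positive harmonic functions $u$ on $G$. Quasihyperbolic metric: $k_G(x,y)=\inf_\gamma\int_\gamma\frac{|dx|}{d_G(x)}$, the infimum being over rectifiable curves $\gamma\subset G$ containing both $x$ and $y$. Hyperbolic metrics: $\cosh\rho_{\mathbb{H}^n}(x,y)=1+\frac{|x-y|^2}{2x_ny_n}$ for $x,y\in\mathbb{H}^n$, and $\sinh^2\frac{\rho_{\mathbb{B}^n}(x,y)}{2}=\frac{|x-y|^2}{(1-|x|^2)(1-|y|^2)}$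 for $x,y\in\mathbb{B}^n$. *)

theory Defs
  imports "HOL-Analysis.Analysis"
begin

section \<open>Harmonic functions\<close>

definition partial_deriv :: "'n::finite \<Rightarrow> (real^'n \<Rightarrow> real) \<Rightarrow> real^'n \<Rightarrow> real" where
  "partial_deriv i u x = deriv (\<lambda>t. u (x + t *\<^sub>R axis i 1)) 0"

text \<open>The functions below are total, but for open \<open>G\<close> everything depends only on the values on \<open>G\<close>.\<close>

definition C1_fun_on :: "(real^'n::finite) set \<Rightarrow> (real^'n \<Rightarrow> real) \<Rightarrow> bool" where
  "C1_fun_on G u \<longleftrightarrow> continuous_on G u \<and>
     (\<forall>i. (\<forall>x\<in>G. (\<lambda>t. u (x + t *\<^sub>R axis i 1)) field_differentiable (at 0)) \<and>
          continuous_on G (partial_deriv i u))"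

definition C2_fun_on :: "(real^'n::finite) set \<Rightarrow> (real^'n \<Rightarrow> real) \<Rightarrow> bool" where
  "C2_fun_on G u \<longleftrightarrow> C1_fun_on G u \<and> (\<forall>i. C1_fun_on G (partial_deriv i u))"

definition laplacian :: "(real^'n::finite \<Rightarrow> real) \<Rightarrow> real^'n \<Rightarrow> real" where
  "laplacian u x = (\<Sum>i\<in>UNIV. partial_deriv i (partial_deriv i u) x)"

definition harmonic_fun_on :: "(real^'n::finite) set \<Rightarrow> (real^'n \<Rightarrow> real) \<Rightarrow> bool" where
  "harmonic_fun_on G u \<longleftrightarrow> C2_fun_on G u \<and> (\<forall>x\<in>G. laplacian u x = 0)"

definition positive_harmonic :: "(real^'n::finite) set \<Rightarrow> (real^'n \<Rightarrow> real) set" where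
  "positive_harmonic G = {u. harmonic_fun_on G u \<and> (\<forall>x\<in>G. 0 < u x)}"

section \<open>Harnack inequality and Harnack metric\<close>

text \<open>For \<open>0 < s < 1\<close> the closed ball \<open>cball x (s * r)\<close> is a compact subset of \<open>G\<close>, so the
  supremum and infimum of the continuous function \<open>u\<close> on it are its maximum and minimum.\<close>

definition harnack_inequality ::
    "real \<Rightarrow> real \<Rightarrow> (real^'n::finite) set \<Rightarrow> (real^'n \<Rightarrow> real) \<Rightarrow> bool" where
  "harnack_inequality s c G u \<longleftrightarrow>
     continuous_on G u \<and> (\<forall>x\<in>G. 0 \<le> u x) \<and>
     (\<forall>x r. 0 < r \<longrightarrow> ball x r \<subseteq> G \<longrightarrow>
        (SUP z\<in>cball x (s * r). u z) \<le> c * (INF z\<in>cball x (s * r). u z))"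

text \<open>The supremum is taken in the extended reals, so an upper bound for it asserts in
  particular that the set of values is bounded.\<close>

definition harnack_metric :: "(real^'n::finite) set \<Rightarrow> real^'n \<Rightarrow> real^'n \<Rightarrow> ereal" where
  "harnack_metric G x y = (SUP u\<in>positive_harmonic G. ereal \<bar>ln (u x / u y)\<bar>)"

section \<open>Integrals along rectifiable curves and the quasihyperbolic metric\<close>

text \<open>Lengths of the polygons inscribed in the restriction of \<open>g\<close> to \<open>{a..b}\<close>.\<close>

definition polygon_lengths :: "(real \<Rightarrow> 'a::metric_space) \<Rightarrow> real \<Rightarrow> real \<Rightarrow> real set" where
  "polygon_lengths g a b =
     {(\<Sum>i<m. dist (g (t i)) (g (t (Suc i)))) | (m::nat) (t::nat \<Rightarrow> real).
        mono t \<and> range t \<subseteq> {a..b}}"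

definition rectifiable_path :: "(real \<Rightarrow> 'a::metric_space) \<Rightarrow> bool" where
  "rectifiable_path g \<longleftrightarrow> path g \<and> bdd_above (polygon_lengths g 0 1)"

definition arc_length :: "(real \<Rightarrow> 'a::metric_space) \<Rightarrow> real \<Rightarrow> real" where
  "arc_length g t = Sup (polygon_lengths g 0 t)"

text \<open>The parametrization of a rectifiable path by arc length. For \<open>0 \<le> \<sigma> \<le> arc_length g 1\<close>
  a parameter \<open>t\<close> as below exists, because \<open>arc_length g\<close> is continuous, and \<open>g t\<close> does not
  depend on its choice, because \<open>g\<close> is constant between two parameters with the same value
  of \<open>arc_length g\<close>.\<close>

definition arc_length_param :: "(real \<Rightarrow> 'a::metric_space) \<Rightarrow> real \<Rightarrow> 'a" where
  "arc_length_param g \<sigma> = g (SOME t. t \<in> {0..1} \<and> arc_length g t = \<sigma>)"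

definition curve_integral :: "('a::metric_space \<Rightarrow> real) \<Rightarrow> (real \<Rightarrow> 'a) \<Rightarrow> real" where
  "curve_integral f g = integral {0..arc_length g 1} (\<lambda>\<sigma>. f (arc_length_param g \<sigma>))"

text \<open>In a domain \<open>G\<close> any two points lie on a rectifiable curve in \<open>G\<close>, and the density is
  continuous and positive on \<open>G\<close>; so below a nonempty set of nonnegative reals is minimized.\<close>

definition quasihyperbolic_metric :: "(real^'n::finite) set \<Rightarrow> real^'n \<Rightarrow> real^'n \<Rightarrow> real" where
  "quasihyperbolic_metric G x y =
     Inf {curve_integral (\<lambda>z. 1 / infdist z (frontier G)) g | g.
            rectifiable_path g \<and> path_image g \<subseteq> G \<and> x \<in> path_image g \<and> y \<in> path_image g}"

section \<open>Hyperbolic metrics\<close>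

definition half_space :: "'n::finite \<Rightarrow> (real^'n) set" where
  "half_space k = {x. 0 < x $ k}"

definition hyp_half_space :: "'n::finite \<Rightarrow> real^'n \<Rightarrow> real^'n \<Rightarrow> real" where
  "hyp_half_space k x y = arcosh (1 + (norm (x - y))\<^sup>2 / (2 * x $ k * y $ k))"

definition hyp_ball :: "real^'n::finite \<Rightarrow> real^'n \<Rightarrow> real" where
  "hyp_ball x y =
     2 * arsinh (sqrt ((norm (x - y))\<^sup>2 / ((1 - (norm x)\<^sup>2) * (1 - (norm y)\<^sup>2))))"

text \<open>The metrics are the nonnegative solutions of the usual defining equations.\<close>

lemma cosh_hyp_half_space:
  assumes "x \<in> half_space k" "y \<in> half_space k"
  shows "cosh (hyp_half_space k x y) = 1 + (norm (x - y))\<^sup>2 / (2 * x $ k * y $ k)"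
    and "0 \<le> hyp_half_space k x y"
proof -
  have "1 \<le> 1 + (norm (x - y))\<^sup>2 / (2 * x $ k * y $ k)"
    using assms by (simp add: half_space_def)
  then show "cosh (hyp_half_space k x y) = 1 + (norm (x - y))\<^sup>2 / (2 * x $ k * y $ k)"
    and "0 \<le> hyp_half_space k x y"
    by (simp_all only: hyp_half_space_def cosh_arcosh_real arcosh_nonneg_real)
qed

lemma sinh_hyp_ball:
  assumes "x \<in> ball 0 1" "y \<in> ball 0 1"
  shows "(sinh (hyp_ball x y / 2))\<^sup>2 =
           (norm (x - y))\<^sup>2 / ((1 - (norm x)\<^sup>2) * (1 - (norm y)\<^sup>2))"
    and "0 \<le> hyp_ball x y"
proof -
  let ?q = "(norm (x - y))\<^sup>2 / ((1 - (norm x)\<^sup>2) * (1 - (norm y)\<^sup>2))"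
  have "0 \<le> 1 - (norm x)\<^sup>2" "0 \<le> 1 - (norm y)\<^sup>2"
    using assms by (simp_all add: power_le_one)
  then have q: "0 \<le> ?q"
    by simp
  then show "(sinh (hyp_ball x y / 2))\<^sup>2 = ?q"
    by (simp add: hyp_ball_def)
  have "0 \<le> sinh (arsinh (sqrt ?q))"
    using q by (simp only: sinh_arsinh_real real_sqrt_ge_zero)
  then show "0 \<le> hyp_ball x y"
    by (simp add: hyp_ball_def del: sinh_arsinh_real)
qed

end

theory Submission
  imports Defs
begin

text \<open>
  The Harnack inequality compares the values of a positive harmonic function at any two points that
  lie in a common ball \<open>cball z (s * r)\<close> with \<open>ball z r \<subseteq> G\<close>: they differ by a factor of at most
  \<open>C s\<close>. If \<open>x\<close> and \<open>y\<close> are joined by a curve of length \<open>T\<close>, measured in some metric, and if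
  any two points of the curve at distance at most \<open>l\<close> along it lie in such a common ball, then
  at most \<open>1 + T / l\<close> steps lead from \<open>x\<close> to \<open>y\<close>, and each of them costs \<open>ln (C s)\<close>
  (\<open>harnack_metric_le_of_chain\<close>). What remains is to find a suitable step length \<open>l\<close>; in
  each case the midpoint of the arc between two points determines their common ball.

  In the hyperbolic case the curve is a geodesic. A hyperbolic ball is also a Euclidean ball, and the
  one of radius \<open>R = artanh s\<close> is contained in \<open>cball c (s * r)\<close> for a Euclidean ball
  \<open>ball c r\<close> inside the domain (\<open>ball_harnack_ball\<close>, \<open>half_space_harnack_ball\<close>). Hence
  \<open>l = 2 * R = ln ((1 + s) / (1 - s))\<close>. Geodesics are curves of the form
  \<open>cosh t X + sinh t V\<close> in the hyperboloid model, to which both domains are isometric, so that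
  the two cases differ only in the choice of the isometry and of the Euclidean balls.

  In the quasihyperbolic case the curve is arbitrary. Let \<open>D\<close> be the distance to the boundary at the
  midpoint \<open>m\<close>. An arc that starts at \<open>m\<close> and has Euclidean length \<open>L\<close> is at
  distance at most \<open>D + \<tau>\<close> from the boundary after length \<open>\<tau>\<close>, so its quasihyperbolic length is at
  least \<open>ln (1 + L / D)\<close>. If it is at most \<open>ln (1 + s)\<close>, then \<open>L \<le> s * D\<close> and the arc lies in
  \<open>cball m (s * D)\<close>. Hence \<open>l = 2 * ln (1 + s)\<close> (\<open>harnack_chain_of_curve\<close>). Passing to the
  infimum over all curves requires that the set of curves be nonempty, and computing with the
  curve integral requires that arc length be continuous, so that the parametrization by arc length
  is defined on the whole interval and is 1-Lipschitz (\<open>arc_length_param_properties\<close>).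
\<close>

section \<open>Harnack chains\<close>

definition harnack_linked :: "real \<Rightarrow> (real^'n::finite) set \<Rightarrow> real^'n \<Rightarrow> real^'n \<Rightarrow> bool" where
  "harnack_linked s G a b \<longleftrightarrow>
     (\<exists>z r. 0 < r \<and> ball z r \<subseteq> G \<and> a \<in> cball z (s * r) \<and> b \<in> cball z (s * r))"

text \<open>
  The argument of \<open>q\<close> stands for the distance from \<open>x\<close> along a curve of total length \<open>T\<close>. All
  pairs at distance at most \<open>l\<close> are linked, and not just those of a fixed subdivision, so that the
  last step may be shorter than \<open>l\<close>.
\<close>
definition harnack_chain ::
    "real \<Rightarrow> (real^'n::finite) set \<Rightarrow> real \<Rightarrow> real \<Rightarrow> real^'n \<Rightarrow> real^'n \<Rightarrow> bool" where
  "harnack_chain s G l T x y \<longleftrightarrow>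
     (\<exists>q. q 0 = x \<and> q T = y \<and>
        (\<forall>t t'. 0 \<le> t \<longrightarrow> t \<le> t' \<longrightarrow> t' \<le> T \<longrightarrow> t' - t \<le> l \<longrightarrow> harnack_linked s G (q t) (q t')))"

lemma harnack_linked_commute: "harnack_linked s G a b \<longleftrightarrow> harnack_linked s G b a"
  unfolding harnack_linked_def by blast

lemma harnack_chain_commute:
  assumes "harnack_chain s G l T x y"
  shows "harnack_chain s G l T y x"
proof -
  obtain q where q: "q 0 = x" "q T = y" and linked:
    "\<And>t t'. 0 \<le> t \<Longrightarrow> t \<le> t' \<Longrightarrow> t' \<le> T \<Longrightarrow> t' - t \<le> l \<Longrightarrow> harnack_linked s G (q t) (q t')"
    using assms unfolding harnack_chain_def by metis
  have "harnack_linked s G (q (T - t)) (q (T - t'))"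
    if "0 \<le> t" "t \<le> t'" "t' \<le> T" "t' - t \<le> l" for t t'
    using linked[of "T - t'" "T - t"] that harnack_linked_commute by force
  then show ?thesis
    unfolding harnack_chain_def using q by (intro exI[of _ "\<lambda>t. q (T - t)"]) auto
qed

lemma harnack_linked_ln_diff_le:
  assumes "0 < s" "s < 1" "1 \<le> c" and H: "harnack_inequality s c G u"
    and pos: "\<And>z. z \<in> G \<Longrightarrow> 0 < u z" and "harnack_linked s G a b"
  shows "\<bar>ln (u a) - ln (u b)\<bar> \<le> ln c"
proof -
  obtain z r where r: "0 < r" "ball z r \<subseteq> G" and a: "a \<in> cball z (s * r)" and b: "b \<in> cball z (s * r)"
    using assms(6) unfolding harnack_linked_def by blast
  have "cball z (s * r) \<subseteq> ball z r"
    using r(1) \<open>s < 1\<close> by (simp add: cball_subset_ball_iff)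
  then have sub: "cball z (s * r) \<subseteq> G"
    using r by blast
  then have "compact (u ` cball z (s * r))"
    using H continuous_on_subset by (intro compact_continuous_image) (auto simp: harnack_inequality_def)
  then have "bounded (u ` cball z (s * r))"
    by (rule compact_imp_bounded)
  then have bdd: "bdd_above (u ` cball z (s * r))" "bdd_below (u ` cball z (s * r))"
    by (auto intro: bounded_imp_bdd_above bounded_imp_bdd_below)
  have le: "u p \<le> c * u q" if "p \<in> cball z (s * r)" "q \<in> cball z (s * r)" for p q
  proof -
    have "u p \<le> (SUP z\<in>cball z (s * r). u z)"
      using bdd(1) that(1) by (rule cSUP_upper2) simp
    also have "\<dots> \<le> c * (INF z\<in>cball z (s * r). u z)"
      using H r unfolding harnack_inequality_def by blast
    also have "\<dots> \<le> c * u q"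
      using cINF_lower[OF bdd(2) that(2)] \<open>1 \<le> c\<close> by (intro mult_left_mono) auto
    finally show ?thesis .
  qed
  have ln_le: "ln (u p) \<le> ln c + ln (u q)" if "p \<in> cball z (s * r)" "q \<in> cball z (s * r)" for p q
  proof -
    have "0 < u p" "0 < u q" using pos sub that by auto
    then have "ln (u p) \<le> ln (c * u q)" using le[OF that] \<open>1 \<le> c\<close> by simp
    also have "\<dots> = ln c + ln (u q)" using \<open>0 < u q\<close> \<open>1 \<le> c\<close> by (simp add: ln_mult)
    finally show ?thesis .
  qed
  show ?thesis using ln_le[OF a b] ln_le[OF b a] by linarith
qed

text \<open>
  The interval is divided into \<open>\<lceil>T / l\<rceil> \<le> 1 + T / l\<close> steps, of which only the last may be shorter
  than \<open>l\<close>.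
\<close>
lemma abs_diff_le_of_steps:
  fixes F :: "real \<Rightarrow> real"
  assumes "0 < l" "0 \<le> T"
    and step: "\<And>t t'. 0 \<le> t \<Longrightarrow> t \<le> t' \<Longrightarrow> t' \<le> T \<Longrightarrow> t' - t \<le> l \<Longrightarrow> \<bar>F t - F t'\<bar> \<le> c"
  shows "\<bar>F 0 - F T\<bar> \<le> (1 + T / l) * c"
proof -
  have c: "0 \<le> c" using step[of 0 0] assms(1,2) by simp
  have ind: "\<bar>F 0 - F (min (n * l) T)\<bar> \<le> n * c" for n :: nat
  proof (induction n)
    case 0
    then show ?case using assms by simp
  next
    case (Suc n)
    have "\<bar>F (min (n * l) T) - F (min (Suc n * l) T)\<bar> \<le> c"
      using assms(1,2) by (intro step) (auto simp: algebra_simps min_def)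
    then show ?case using Suc by (simp add: algebra_simps)
  qed
  define n where "n = nat \<lceil>T / l\<rceil>"
  have n: "T / l \<le> n" "n \<le> 1 + T / l"
    using assms(1,2) unfolding n_def by (auto simp: of_nat_nat) linarith+
  then have "min (n * l) T = T" using assms(1) by (simp add: field_simps)
  then have "\<bar>F 0 - F T\<bar> \<le> n * c" using ind[of n] by simp
  also have "\<dots> \<le> (1 + T / l) * c" using n c by (intro mult_right_mono)
  finally show ?thesis .
qed

lemma harnack_metric_le_of_chain:
  assumes "0 < s" "s < 1" "1 \<le> c" "0 < l" "0 \<le> T" and x: "x \<in> G" and y: "y \<in> G"
    and H: "\<And>u. u \<in> positive_harmonic G \<Longrightarrow> harnack_inequality s c G u"
    and chain: "harnack_chain s G l T x y"
  shows "harnack_metric G x y \<le> ereal ((1 + T / l) * ln c)"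
  unfolding harnack_metric_def
proof (rule SUP_least)
  fix u assume u: "u \<in> positive_harmonic G"
  then have pos: "\<And>z. z \<in> G \<Longrightarrow> 0 < u z" by (auto simp: positive_harmonic_def)
  obtain q where q: "q 0 = x" "q T = y" and linked:
    "\<And>t t'. 0 \<le> t \<Longrightarrow> t \<le> t' \<Longrightarrow> t' \<le> T \<Longrightarrow> t' - t \<le> l \<Longrightarrow> harnack_linked s G (q t) (q t')"
    using chain unfolding harnack_chain_def by metis
  have "\<bar>ln (u (q 0)) - ln (u (q T))\<bar> \<le> (1 + T / l) * ln c"
  proof (rule abs_diff_le_of_steps[where F = "\<lambda>t. ln (u (q t))"])
    show "\<bar>ln (u (q t)) - ln (u (q t'))\<bar> \<le> ln c"
      if "0 \<le> t" "t \<le> t'" "t' \<le> T" "t' - t \<le> l" for t t'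
      using assms(1-3) H[OF u] pos linked[OF that] by (rule harnack_linked_ln_diff_le)
  qed fact+
  then show "ereal \<bar>ln (u x / u y)\<bar> \<le> ereal ((1 + T / l) * ln c)"
    using pos[OF x] pos[OF y] q by (simp add: ln_div)
qed

section \<open>Hyperboloid models and their geodesics\<close>

definition lorentz :: "real \<times> 'a::real_inner \<Rightarrow> real \<times> 'a \<Rightarrow> real" where
  "lorentz X Y = fst X * fst Y - snd X \<bullet> snd Y"

definition hyperboloid :: "(real \<times> 'a::real_inner) set" where
  "hyperboloid = {X. lorentz X X = 1 \<and> 0 < fst X}"

lemma lorentz_linear:
  "lorentz (X + Y) Z = lorentz X Z + lorentz Y Z"
  "lorentz Z (X + Y) = lorentz Z X + lorentz Z Y"
  "lorentz (X - Y) Z = lorentz X Z - lorentz Y Z"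
  "lorentz Z (X - Y) = lorentz Z X - lorentz Z Y"
  "lorentz (c *\<^sub>R X) Z = c * lorentz X Z"
  "lorentz Z (c *\<^sub>R X) = c * lorentz Z X"
  by (simp_all add: lorentz_def algebra_simps inner_simps)

lemma lorentz_commute: "lorentz X Y = lorentz Y X"
  by (simp add: lorentz_def inner_commute)

text \<open>
  Unit vectors of the Lorentz form lie inside the light cone.
\<close>
lemma norm_snd_less_abs_fst:
  assumes "lorentz X X = 1"
  shows "norm (snd X) < \<bar>fst X\<bar>"
proof -
  have "(norm (snd X))\<^sup>2 < \<bar>fst X\<bar>\<^sup>2"
    using assms by (simp add: lorentz_def power2_norm_eq_inner) (simp add: power2_eq_square)
  then show ?thesis by (rule power_less_imp_less_base) simp
qed

text \<open>
  The set of unit vectors has two sheets, and vectors from opposite sheets have a negative Lorentz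
  product by the Cauchy--Schwarz inequality, since they lie inside the light cone. This selects the sheet of the points
  of a geodesic.
\<close>
lemma hyperboloid_sheet:
  assumes X: "X \<in> hyperboloid" and Z: "lorentz Z Z = 1" and XZ: "0 < lorentz X Z"
  shows "Z \<in> hyperboloid"
proof -
  have "0 < fst Z"
  proof (rule ccontr)
    assume "\<not> 0 < fst Z"
    then have "norm (snd Z) \<le> - fst Z" using norm_snd_less_abs_fst[OF Z] by linarith
    moreover have "norm (snd X) \<le> fst X" "0 < fst X"
      using X norm_snd_less_abs_fst[of X] by (auto simp: hyperboloid_def)
    ultimately have "norm (snd X) * norm (snd Z) \<le> fst X * (- fst Z)"
      by (intro mult_mono) auto
    moreover have "- (snd X \<bullet> snd Z) \<le> norm (snd X) * norm (snd Z)"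
      using Cauchy_Schwarz_ineq2[of "snd X" "snd Z"] by linarith
    ultimately show False using XZ by (simp add: lorentz_def)
  qed
  with Z show ?thesis by (simp add: hyperboloid_def)
qed

text \<open>
  With \<open>V\<close> the unit tangent vector at \<open>X\<close> that points towards \<open>Y\<close>, the geodesic is
  \<open>cosh t X + sinh t V\<close>, and the distances along it are given by the addition theorem for
  \<open>cosh\<close>.
\<close>
lemma hyperboloid_geodesic:
  assumes X: "X \<in> hyperboloid" and Y: "Y \<in> hyperboloid" and "0 < T" and XY: "lorentz X Y = cosh T"
  obtains Z where "Z 0 = X" "Z T = Y" "\<And>t. Z t \<in> hyperboloid"
    "\<And>t t'. lorentz (Z t) (Z t') = cosh (t - t')"
proof -
  define V where "V = (1 / sinh T) *\<^sub>R (Y - cosh T *\<^sub>R X)"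
  define Z where "Z t = cosh t *\<^sub>R X + sinh t *\<^sub>R V" for t :: real
  have T: "0 < sinh T" using \<open>0 < T\<close> by simp
  have XX: "lorentz X X = 1" and YY: "lorentz Y Y = 1" and YX: "lorentz Y X = cosh T"
    using X Y XY by (auto simp: hyperboloid_def lorentz_commute)
  have XV: "lorentz X V = 0" and VX: "lorentz V X = 0"
    by (simp_all add: V_def lorentz_linear XX XY YX)
  have "(sinh T)\<^sup>2 * lorentz V V = 1 - (cosh T)\<^sup>2"
    using T by (simp add: V_def lorentz_linear XX XY YX YY power2_eq_square field_simps)
  also have "\<dots> = (sinh T)\<^sup>2 * (- 1)" using hyperbolic_pythagoras[of T] by linarith
  finally have VV: "lorentz V V = - 1"
    using T by (simp only: mult_cancel_left) simp
  have form: "lorentz (Z t) (Z t') = cosh (t - t')" for t t'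
    by (simp add: Z_def lorentz_linear XX XV VX VV cosh_diff)
  have "Z t \<in> hyperboloid" for t
    using X by (rule hyperboloid_sheet) (simp_all add: form, simp add: Z_def lorentz_linear XX XV)
  moreover have "Z 0 = X" "Z T = Y"
    using T by (simp_all add: Z_def V_def scaleR_diff_right)
  ultimately show thesis using that form by blast
qed

text \<open>
  Both hyperbolic metrics have the form \<open>cosh \<rho> = 1 + |x - y|\<^sup>2 / (2 w(x) w(y))\<close>, with the weight
  \<open>w(x) = x\<^sub>k\<close> on the half-space and \<open>w(x) = (1 - |x|\<^sup>2) / 2\<close> on the ball; \<open>\<Phi>\<close> is an isometry
  onto the hyperboloid. The assumption on balls says that the hyperbolic ball of radius \<open>R\<close>
  about \<open>z\<close> lies in a ball to which the Harnack inequality applies. Two points of a geodesic at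
  distance at most \<open>2 * R\<close> are in the hyperbolic ball of radius \<open>R\<close> about their midpoint.
\<close>
lemma harnack_chain_of_hyperboloid_model:
  fixes w :: "real^'n::finite \<Rightarrow> real" and \<Phi> :: "real^'n \<Rightarrow> real \<times> (real^'n)"
  assumes into: "\<And>x. x \<in> G \<Longrightarrow> 0 < fst (\<Phi> x)"
    and form: "\<And>x y. x \<in> G \<Longrightarrow> y \<in> G \<Longrightarrow>
      lorentz (\<Phi> x) (\<Phi> y) = 1 + (norm (x - y))\<^sup>2 / (2 * w x * w y)"
    and pos: "\<And>x. x \<in> G \<Longrightarrow> 0 < w x"
    and onto: "\<And>X. X \<in> hyperboloid \<Longrightarrow> \<exists>x\<in>G. \<Phi> x = X"
    and balls: "\<And>z. z \<in> G \<Longrightarrow> \<exists>c r. 0 < r \<and> ball c r \<subseteq> G \<and>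
      (\<forall>a\<in>G. (norm (z - a))\<^sup>2 \<le> 2 * w z * w a * (cosh R - 1) \<longrightarrow> a \<in> cball c (s * r))"
    and R: "0 \<le> R" and x: "x \<in> G" and y: "y \<in> G" and "0 \<le> T"
    and T: "cosh T = 1 + (norm (x - y))\<^sup>2 / (2 * w x * w y)"
  shows "harnack_chain s G (2 * R) T x y"
proof -
  have linked: "harnack_linked s G a b"
    if "z \<in> G" "a \<in> G" "b \<in> G" "lorentz (\<Phi> z) (\<Phi> a) \<le> cosh R" "lorentz (\<Phi> z) (\<Phi> b) \<le> cosh R" for z a b
  proof -
    have near: "(norm (z - p))\<^sup>2 \<le> 2 * w z * w p * (cosh R - 1)"
      if "p \<in> G" "lorentz (\<Phi> z) (\<Phi> p) \<le> cosh R" for p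
    proof -
      have "(norm (z - p))\<^sup>2 / (2 * w z * w p) \<le> cosh R - 1"
        using that form[OF \<open>z \<in> G\<close> \<open>p \<in> G\<close>] by linarith
      then show ?thesis using pos[OF \<open>z \<in> G\<close>] pos[OF \<open>p \<in> G\<close>] by (simp add: field_simps)
    qed
    show ?thesis
      using balls[OF \<open>z \<in> G\<close>] near[OF that(2,4)] near[OF that(3,5)] that(2,3)
      unfolding harnack_linked_def by blast
  qed
  have self: "lorentz (\<Phi> z) (\<Phi> z) = 1" if "z \<in> G" for z
    using form[OF that that] by simp
  show ?thesis
  proof (cases "T = 0")
    case True
    then have "x = y" using T pos[OF x] pos[OF y] by simp
    moreover have "harnack_linked s G x x"
      using linked[OF x x x] self[OF x] cosh_real_ge_1[of R] by simp
    ultimately show ?thesis unfolding harnack_chain_def by (intro exI[of _ "\<lambda>_. x"]) simp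
  next
    case False
    have "\<Phi> x \<in> hyperboloid" "\<Phi> y \<in> hyperboloid" using into self x y by (auto simp: hyperboloid_def)
    then obtain Z where Z: "Z 0 = \<Phi> x" "Z T = \<Phi> y" "\<And>t. Z t \<in> hyperboloid"
      and ZZ: "\<And>t t'. lorentz (Z t) (Z t') = cosh (t - t')"
      using hyperboloid_geodesic[of "\<Phi> x" "\<Phi> y" T] False \<open>0 \<le> T\<close> form[OF x y] T by auto
    \<comment> \<open>The preimages at the ends are chosen as \<open>x\<close> and \<open>y\<close>.\<close>
    have "\<forall>t. \<exists>p\<in>G. \<Phi> p = Z t \<and> (t = 0 \<longrightarrow> p = x) \<and> (t = T \<longrightarrow> p = y)"
    proof
      fix t
      show "\<exists>p\<in>G. \<Phi> p = Z t \<and> (t = 0 \<longrightarrow> p = x) \<and> (t = T \<longrightarrow> p = y)"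
        using x y Z onto[of "Z t"] False by (cases "t = 0"; cases "t = T") auto
    qed
    then obtain q where q: "\<And>t. q t \<in> G" "\<And>t. \<Phi> (q t) = Z t" "q 0 = x" "q T = y"
      by metis
    have "harnack_linked s G (q t) (q t')" if "t \<le> t'" "t' - t \<le> 2 * R" for t t'
    proof -
      have "cosh ((t' - t) / 2) \<le> cosh R"
        using that R by (subst cosh_real_nonneg_le_iff) auto
      moreover have "(t + t') / 2 - t = (t' - t) / 2" "(t + t') / 2 - t' = - ((t' - t) / 2)"
        by (simp_all add: field_simps)
      ultimately show ?thesis
        using q(1) by (intro linked[of "q ((t + t') / 2)"]) (simp_all only: q(2) ZZ cosh_minus)
    qed
    then show ?thesis unfolding harnack_chain_def using q(3,4) by blast
  qed
qed

section \<open>The unit ball and the half-space\<close>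

text \<open>
  Here \<open>R = artanh s\<close>, that is, \<open>tanh R = s\<close>.
\<close>
lemma harnack_radius:
  fixes s :: real
  assumes "0 < s" "s < 1"
  defines "R \<equiv> ln ((1 + s) / (1 - s)) / 2"
  shows "0 < R" "(s * cosh R)\<^sup>2 = (cosh R)\<^sup>2 - 1" "1 < cosh R"
proof -
  show R: "0 < R" using assms by (simp add: R_def field_simps)
  have "exp (- (2 * R)) = (1 - s) / (1 + s)" using assms by (simp add: R_def exp_minus)
  then have "tanh R = (1 - (1 - s) / (1 + s)) / (1 + (1 - s) / (1 + s))"
    by (simp add: tanh_real_altdef)
  also have "\<dots> = s" using assms(1) by (simp add: divide_simps)
  finally have "tanh R = s" .
  then have "sinh R = s * cosh R" by (simp add: tanh_def field_simps)
  then show "(s * cosh R)\<^sup>2 = (cosh R)\<^sup>2 - 1" using hyperbolic_pythagoras[of R] by simp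
  show "1 < cosh R" using cosh_real_nonneg_less_iff[of 0 R] R by simp
qed

text \<open>
  With \<open>ch = cosh R\<close>, the points \<open>a\<close> in question form the hyperbolic ball of radius \<open>R\<close> about
  \<open>z\<close>. Completing the square in the inequality shows that it is a Euclidean ball with center
  \<open>c = z / (1 + m)\<close>, where \<open>m = (1 - |z|\<^sup>2) sinh\<^sup>2(R / 2)\<close>. The comparison of its radius with
  \<open>s * (1 - |c|)\<close> comes down to \<open>(1 + \<alpha>) cosh R \<le> (1 + \<alpha>) cosh R + (1 - \<alpha>)\<close> with \<open>\<alpha> = |z|\<close>.
\<close>
lemma ball_harnack_ball:
  fixes z :: "real^'n::finite"
  assumes s: "0 < s" "s < 1" and ch: "(s * ch)\<^sup>2 = ch\<^sup>2 - 1" "1 < ch" and z: "norm z < 1"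
  shows "\<exists>c r. 0 < r \<and> ball c r \<subseteq> ball 0 1 \<and>
    (\<forall>a\<in>ball 0 1. (norm (z - a))\<^sup>2 \<le> 2 * ((1 - (norm z)\<^sup>2) / 2) * ((1 - (norm a)\<^sup>2) / 2) * (ch - 1)
       \<longrightarrow> a \<in> cball c (s * r))"
proof -
  define k where "k = (ch - 1) / 2"
  define \<alpha> where "\<alpha> = norm z"
  define m where "m = k * (1 - \<alpha>\<^sup>2)"
  define c where "c = (1 / (1 + m)) *\<^sub>R z"
  define r where "r = 1 - norm c"
  have \<alpha>: "0 \<le> \<alpha>" "\<alpha> < 1" using z by (auto simp: \<alpha>_def)
  have k: "0 < k" using ch by (simp add: k_def)
  have "\<alpha>\<^sup>2 < 1" using \<alpha> by (simp add: power_less_one_iff)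
  then have m: "0 < m" using k by (simp add: m_def)
  have nc: "norm c = \<alpha> / (1 + m)" using m by (simp add: c_def \<alpha>_def)
  have r: "0 < r" "r = (1 + m - \<alpha>) / (1 + m)" using \<alpha> m by (simp_all add: r_def nc field_simps)
  have radius: "m * (1 + m - \<alpha>\<^sup>2) \<le> (s * (1 + m - \<alpha>))\<^sup>2"
  proof -
    \<comment> \<open>This is \<open>sinh\<^sup>2(R / 2) cosh\<^sup>2(R / 2) = (sinh R / 2)\<^sup>2\<close>.\<close>
    have kk: "k * (1 + k) = (s * ch / 2)\<^sup>2"
      using ch(1) by (simp add: k_def field_simps power2_eq_square)
    have "m * (1 + m - \<alpha>\<^sup>2) = k * (1 + k) * (1 - \<alpha>\<^sup>2)\<^sup>2"
      by (simp add: m_def algebra_simps power2_eq_square)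
    also have "\<dots> = ((1 - \<alpha>) * (s * ((1 + \<alpha>) * ch / 2)))\<^sup>2"
      unfolding kk by (simp add: algebra_simps power2_eq_square)
    also have "\<dots> \<le> ((1 - \<alpha>) * (s * (1 + k * (1 + \<alpha>))))\<^sup>2"
    proof -
      have "(1 + \<alpha>) * ch / 2 \<le> 1 + k * (1 + \<alpha>)"
        using \<alpha> by (simp add: k_def field_simps)
      moreover have "0 \<le> (1 + \<alpha>) * ch / 2" using \<alpha> ch by simp
      ultimately show ?thesis using \<alpha> s by (intro power_mono mult_left_mono) auto
    qed
    also have "(1 - \<alpha>) * (s * (1 + k * (1 + \<alpha>))) = s * (1 + m - \<alpha>)"
      by (simp add: m_def algebra_simps power2_eq_square)
    finally show ?thesis .
  qed
  have "a \<in> cball c (s * r)"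
    if a: "(norm (z - a))\<^sup>2 \<le> 2 * ((1 - (norm z)\<^sup>2) / 2) * ((1 - (norm a)\<^sup>2) / 2) * (ch - 1)" for a
  proof -
    have "\<alpha>\<^sup>2 + (norm a)\<^sup>2 - 2 * (z \<bullet> a) \<le> m * (1 - (norm a)\<^sup>2)"
      using a by (simp add: \<alpha>_def m_def k_def power2_norm_eq_inner inner_diff inner_commute field_simps)
    then have 1: "(1 + m) * (norm a)\<^sup>2 - 2 * (z \<bullet> a) \<le> m - \<alpha>\<^sup>2"
      by (simp add: algebra_simps)
    have "((1 + m) * norm (a - c))\<^sup>2 = (norm ((1 + m) *\<^sub>R a - z))\<^sup>2"
    proof -
      have "(1 + m) *\<^sub>R a - z = (1 + m) *\<^sub>R (a - c)" using m by (simp add: c_def scaleR_diff_right)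
      then show ?thesis using m by simp
    qed
    also have "\<dots> = (1 + m) * ((1 + m) * (norm a)\<^sup>2 - 2 * (z \<bullet> a)) + \<alpha>\<^sup>2"
      unfolding power2_norm_eq_inner \<alpha>_def
      by (simp only: inner_diff_left inner_diff_right inner_scaleR_left inner_scaleR_right inner_commute[of a z])
         (simp add: algebra_simps)
    also have "\<dots> \<le> (1 + m) * (m - \<alpha>\<^sup>2) + \<alpha>\<^sup>2"
      using mult_left_mono[OF 1, of "1 + m"] m by simp
    also have "\<dots> = m * (1 + m - \<alpha>\<^sup>2)" by (simp add: algebra_simps)
    also have "\<dots> \<le> (s * (1 + m - \<alpha>))\<^sup>2" by (rule radius)
    finally have "(1 + m) * norm (a - c) \<le> s * (1 + m - \<alpha>)"
      by (rule power2_le_imp_le) (use \<alpha> m s in simp)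
    then have "norm (a - c) \<le> s * (1 + m - \<alpha>) / (1 + m)"
      using m by (subst pos_le_divide_eq) (auto simp: mult.commute)
    then have "norm (a - c) \<le> s * r" using r(2) by simp
    then show ?thesis by (simp add: dist_norm norm_minus_commute)
  qed
  moreover have "ball c r \<subseteq> ball 0 1"
  proof
    fix p assume "p \<in> ball c r"
    then show "p \<in> ball 0 1"
      using dist_triangle[of 0 p c] by (simp add: r_def)
  qed
  ultimately show ?thesis using r by blast
qed

text \<open>
  The isometry \<open>\<Phi>\<close> is the inverse of the stereographic projection \<open>(t, v) \<mapsto> v / (1 + t)\<close>.
\<close>
lemma harnack_chain_ball:
  fixes x y :: "real^'n::finite"
  assumes s: "0 < s" "s < 1" and x: "x \<in> ball 0 1" and y: "y \<in> ball 0 1"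
  shows "harnack_chain s (ball 0 1) (ln ((1 + s) / (1 - s))) (hyp_ball x y) x y"
proof -
  define R where "R = ln ((1 + s) / (1 - s)) / 2"
  define w where "w z = (1 - (norm z)\<^sup>2) / 2" for z :: "real^'n"
  define \<Phi> where "\<Phi> z = ((1 + (norm z)\<^sup>2) / (2 * w z), (1 / w z) *\<^sub>R z)" for z :: "real^'n"
  have w: "0 < w z" if "z \<in> ball 0 1" for z
    using that by (simp add: w_def power_less_one_iff)
  have form: "lorentz (\<Phi> a) (\<Phi> b) = 1 + (norm (a - b))\<^sup>2 / (2 * w a * w b)"
    if "a \<in> ball 0 1" "b \<in> ball 0 1" for a b
  proof -
    have "(1 + (norm a)\<^sup>2) * (1 + (norm b)\<^sup>2) / 4 - a \<bullet> b = w a * w b + (norm (a - b))\<^sup>2 / 2"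
      by (simp add: w_def power2_norm_eq_inner inner_diff inner_commute field_simps)
    moreover have "lorentz (\<Phi> a) (\<Phi> b) =
        ((1 + (norm a)\<^sup>2) * (1 + (norm b)\<^sup>2) / 4 - a \<bullet> b) / (w a * w b)"
      by (simp add: lorentz_def \<Phi>_def diff_divide_distrib)
    ultimately show ?thesis
      using w[OF that(1)] w[OF that(2)] by (simp add: add_divide_distrib)
  qed
  have onto: "\<exists>z\<in>ball 0 1. \<Phi> z = X" if "X \<in> hyperboloid" for X
  proof -
    obtain t v where X: "X = (t, v)" by (cases X)
    have t: "0 < t" and tv: "(norm v)\<^sup>2 = t\<^sup>2 - 1"
      using that by (auto simp: hyperboloid_def lorentz_def X power2_norm_eq_inner)
        (simp add: power2_eq_square)
    define z where "z = (1 / (1 + t)) *\<^sub>R v"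
    have nz: "(norm z)\<^sup>2 = (t - 1) / (t + 1)"
    proof -
      have "(norm z)\<^sup>2 = (t\<^sup>2 - 1) / (t + 1)\<^sup>2"
        using t by (simp add: z_def power_divide tv add.commute)
      also have "\<dots> = (t - 1) * (t + 1) / ((t + 1) * (t + 1))"
        by (simp add: power2_eq_square algebra_simps)
      also have "\<dots> = (t - 1) / (t + 1)" using t by simp
      finally show ?thesis .
    qed
    then have wz: "w z = 1 / (1 + t)" using t by (simp add: w_def field_simps)
    have "(norm z)\<^sup>2 < 1" unfolding nz using t by simp
    then have "z \<in> ball 0 1" by (simp add: power_less_one_iff)
    moreover have "\<Phi> z = X"
      using t by (simp add: \<Phi>_def wz nz X) (simp add: z_def field_simps)
    ultimately show ?thesis by blast
  qed
  have "harnack_chain s (ball 0 1) (2 * R) (hyp_ball x y) x y"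
  proof (rule harnack_chain_of_hyperboloid_model[where w = w and \<Phi> = \<Phi>])
    show "0 < fst (\<Phi> z)" if "z \<in> ball 0 1" for z
      using w[OF that] by (simp add: \<Phi>_def add_pos_nonneg)
    show "\<exists>c r. 0 < r \<and> ball c r \<subseteq> ball 0 1 \<and>
      (\<forall>a\<in>ball 0 1. (norm (z - a))\<^sup>2 \<le> 2 * w z * w a * (cosh R - 1) \<longrightarrow> a \<in> cball c (s * r))"
      if "z \<in> ball 0 1" for z
      unfolding w_def using that harnack_radius[OF s] s by (intro ball_harnack_ball) (auto simp: R_def)
    have half: "2 * (q / (A * B)) = q / (2 * (A / 2) * (B / 2))" for q A B :: real by simp
    have "cosh (hyp_ball x y) = 1 + 2 * (sinh (hyp_ball x y / 2))\<^sup>2"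
      using cosh_double[of "hyp_ball x y / 2"] cosh_square_eq[of "hyp_ball x y / 2"] by simp
    then show "cosh (hyp_ball x y) = 1 + (norm (x - y))\<^sup>2 / (2 * w x * w y)"
      unfolding sinh_hyp_ball(1)[OF x y] half w_def .
    show "0 \<le> hyp_ball x y" using sinh_hyp_ball(2)[OF x y] .
    show "0 \<le> R" using harnack_radius(1)[OF s] by (simp add: R_def)
  qed (use w form onto x y in auto)
  then show ?thesis by (simp add: R_def)
qed

text \<open>
  With \<open>ch = cosh R\<close>, the hyperbolic ball of radius \<open>R\<close> about \<open>z\<close> is the Euclidean ball whose
  center \<open>c\<close> lies above \<open>z\<close> at height \<open>z\<^sub>k cosh R\<close> and whose radius is
  \<open>z\<^sub>k sinh R = s z\<^sub>k cosh R\<close>; the ball about \<open>c\<close> of radius \<open>z\<^sub>k cosh R\<close> touches the boundary.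
\<close>
lemma half_space_harnack_ball:
  fixes z :: "real^'n::finite"
  assumes s: "0 < s" "s < 1" and ch: "(s * ch)\<^sup>2 = ch\<^sup>2 - 1" "1 < ch" and z: "0 < z $ k"
  shows "\<exists>c r. 0 < r \<and> ball c r \<subseteq> half_space k \<and>
    (\<forall>a\<in>half_space k. (norm (z - a))\<^sup>2 \<le> 2 * z $ k * a $ k * (ch - 1) \<longrightarrow> a \<in> cball c (s * r))"
proof -
  define h where "h = z $ k * (ch - 1)"
  define r where "r = z $ k * ch"
  define c where "c = z + axis k h"
  have r: "0 < r" using ch z by (simp add: r_def)
  have "ball c r \<subseteq> half_space k"
  proof
    fix p assume "p \<in> ball c r"
    then have "\<bar>(c - p) $ k\<bar> < r"
      using component_le_norm_cart[of "c - p" k] by (simp add: dist_norm)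
    moreover have "c $ k = r" by (simp add: c_def r_def h_def algebra_simps)
    ultimately show "p \<in> half_space k" by (simp add: half_space_def)
  qed
  moreover have "a \<in> cball c (s * r)" if a: "(norm (z - a))\<^sup>2 \<le> 2 * z $ k * a $ k * (ch - 1)" for a
  proof -
    have "(norm (c - a))\<^sup>2 = (norm (z - a))\<^sup>2 + 2 * h * (z $ k - a $ k) + h\<^sup>2"
    proof -
      have "c - a = (z - a) + axis k h" by (simp only: c_def diff_add_eq)
      moreover have "(norm (v + axis k h))\<^sup>2 = (norm v)\<^sup>2 + 2 * h * v $ k + h\<^sup>2" for v :: "real^'n"
        unfolding power2_norm_eq_inner inner_add_left inner_add_right
        by (simp only: inner_axis inner_axis' axis_eq_axis real_inner_1_right inner_real_def power2_eq_square) simp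
      ultimately show ?thesis by (simp only: vector_minus_component)
    qed
    also have "\<dots> \<le> 2 * h * z $ k + h\<^sup>2"
    proof -
      have "2 * z $ k * a $ k * (ch - 1) = 2 * h * a $ k" by (simp add: h_def)
      then show ?thesis using a by (simp add: right_diff_distrib)
    qed
    also have "\<dots> = (z $ k)\<^sup>2 * (ch\<^sup>2 - 1)"
      by (simp add: h_def algebra_simps power2_eq_square)
    also have "\<dots> = (s * r)\<^sup>2"
      unfolding ch(1)[symmetric] by (simp add: r_def power_mult_distrib)
    finally have "norm (c - a) \<le> s * r" by (rule power2_le_imp_le) (use s r in simp)
    then show ?thesis by (simp add: dist_norm)
  qed
  ultimately show ?thesis using r by blast
qed

text \<open>
  The isometry \<open>\<Phi>\<close> maps \<open>z\<close> to \<open>(|z|\<^sup>2 + 1, 2 z', |z|\<^sup>2 - 1) / (2 z\<^sub>k)\<close>, where \<open>z'\<close> is the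
  horizontal part of \<open>z\<close>; the last entry is the component in the direction of \<open>e\<close>. The height of
  the preimage of \<open>(t, v)\<close> is \<open>1 / (t - v\<^sub>k)\<close>.
\<close>
lemma harnack_chain_half_space:
  fixes x y :: "real^'n::finite"
  assumes s: "0 < s" "s < 1" and x: "x \<in> half_space k" and y: "y \<in> half_space k"
  shows "harnack_chain s (half_space k) (ln ((1 + s) / (1 - s))) (hyp_half_space k x y) x y"
proof -
  define R where "R = ln ((1 + s) / (1 - s)) / 2"
  define e :: "real^'n" where "e = axis k 1"
  have e: "e \<bullet> e = 1" "e \<bullet> z = z $ k" "z \<bullet> e = z $ k" "e $ k = 1" for z
    by (simp_all add: e_def inner_axis inner_axis')
  define \<Phi> where "\<Phi> z = (1 / (2 * z $ k)) *\<^sub>R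
    ((norm z)\<^sup>2 + 1, 2 *\<^sub>R z + ((norm z)\<^sup>2 - 1 - 2 * z $ k) *\<^sub>R e)" for z
  have form: "lorentz (\<Phi> a) (\<Phi> b) = 1 + (norm (a - b))\<^sup>2 / (2 * a $ k * b $ k)"
    if "a \<in> half_space k" "b \<in> half_space k" for a b
  proof -
    have ab: "0 < a $ k" "0 < b $ k" using that by (auto simp: half_space_def)
    let ?L = "lorentz ((norm a)\<^sup>2 + 1, 2 *\<^sub>R a + ((norm a)\<^sup>2 - 1 - 2 * a $ k) *\<^sub>R e)
      ((norm b)\<^sup>2 + 1, 2 *\<^sub>R b + ((norm b)\<^sup>2 - 1 - 2 * b $ k) *\<^sub>R e)"
    have "?L = 4 * a $ k * b $ k + 2 * (norm (a - b))\<^sup>2"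
      unfolding power2_norm_eq_inner lorentz_def
      by (simp add: inner_add_left inner_add_right inner_diff_left inner_diff_right e inner_commute[of b a])
         (simp add: algebra_simps)
    then show ?thesis
      unfolding \<Phi>_def lorentz_linear using ab by (simp add: field_simps)
  qed
  have onto: "\<exists>z\<in>half_space k. \<Phi> z = X" if "X \<in> hyperboloid" for X
  proof -
    obtain t v where X: "X = (t, v)" by (cases X)
    have t: "0 < t" and vv: "v \<bullet> v = t\<^sup>2 - 1" and "lorentz X X = 1"
      using that by (auto simp: hyperboloid_def lorentz_def X power2_eq_square)
    then have "norm v < t" using norm_snd_less_abs_fst[of X] by (simp add: X)
    then have "0 < t - v $ k" using component_le_norm_cart[of v k] by linarith
    define h where "h = 1 / (t - v $ k)"
    have h: "0 < h" "v $ k = t - 1 / h" using \<open>0 < t - v $ k\<close> by (simp_all add: h_def)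
    define z where "z = h *\<^sub>R (v + (1 - v $ k) *\<^sub>R e)"
    have zk: "z $ k = h" by (simp add: z_def e)
    have "z \<bullet> z = h\<^sup>2 * (v \<bullet> v + 2 * (1 - v $ k) * v $ k + (1 - v $ k)\<^sup>2)"
      by (simp add: z_def inner_add_left inner_add_right e power2_eq_square algebra_simps)
    also have "\<dots> = 2 * h * t - 1"
      unfolding vv h(2) using h(1) by (simp add: field_simps power2_eq_square)
    finally have zz: "(norm z)\<^sup>2 = 2 * h * t - 1" by (simp add: power2_norm_eq_inner)
    have "fst (\<Phi> z) = t" using h(1) by (simp add: \<Phi>_def zz zk)
    moreover have "snd (\<Phi> z) = v"
    proof -
      have "snd (\<Phi> z) = (1 / h) *\<^sub>R z + ((2 * h * t - 2 - 2 * h) / (2 * h)) *\<^sub>R e"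
        using h(1) by (simp add: \<Phi>_def zz zk scaleR_add_right)
      also have "(1 / h) *\<^sub>R z = v + (1 - v $ k) *\<^sub>R e" using h(1) by (simp add: z_def)
      also have "(2 * h * t - 2 - 2 * h) / (2 * h) = - (1 - v $ k)"
        using h(1) unfolding h(2) by (simp add: field_simps)
      finally show ?thesis by (simp add: scaleR_diff_left)
    qed
    ultimately have "\<Phi> z = X" by (simp add: X prod_eq_iff)
    then show ?thesis using h(1) zk by (auto simp: half_space_def)
  qed
  have "harnack_chain s (half_space k) (2 * R) (hyp_half_space k x y) x y"
  proof (rule harnack_chain_of_hyperboloid_model[where w = "\<lambda>z. z $ k" and \<Phi> = \<Phi>])
    show "0 < fst (\<Phi> z)" if "z \<in> half_space k" for z
      using that by (simp add: \<Phi>_def half_space_def add_nonneg_pos)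
    show "\<exists>c r. 0 < r \<and> ball c r \<subseteq> half_space k \<and>
      (\<forall>a\<in>half_space k. (norm (z - a))\<^sup>2 \<le> 2 * z $ k * a $ k * (cosh R - 1) \<longrightarrow> a \<in> cball c (s * r))"
      if "z \<in> half_space k" for z
    proof (rule half_space_harnack_ball)
      show "(s * cosh R)\<^sup>2 = (cosh R)\<^sup>2 - 1" "1 < cosh R"
        unfolding R_def by (rule harnack_radius[OF s])+
      show "0 < z $ k" using that by (simp add: half_space_def)
    qed fact+
    show "cosh (hyp_half_space k x y) = 1 + (norm (x - y))\<^sup>2 / (2 * x $ k * y $ k)"
      "0 \<le> hyp_half_space k x y"
      using cosh_hyp_half_space[OF x y] by auto
    show "0 \<le> R" using harnack_radius(1)[OF s] by (simp add: R_def)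
    show "0 < z $ k" if "z \<in> half_space k" for z using that by (simp add: half_space_def)
  qed (use form onto x y in auto)
  then show ?thesis by (simp add: R_def)
qed

section \<open>Length of curves and the arc length parametrization\<close>

abbreviation curve_length :: "(real \<Rightarrow> 'a::metric_space) \<Rightarrow> real \<Rightarrow> real \<Rightarrow> real" where
  "curve_length g a b \<equiv> Sup (polygon_lengths g a b)"

lemma polygon_lengthsI:
  "mono t \<Longrightarrow> range t \<subseteq> {a..b} \<Longrightarrow> (\<Sum>i<m. dist (g (t i)) (g (t (Suc i)))) \<in> polygon_lengths g a b"
  unfolding polygon_lengths_def by blast

lemma polygon_lengths_nonempty:
  assumes "a \<le> b" shows "polygon_lengths g a b \<noteq> {}"
  using polygon_lengthsI[of "\<lambda>_. a" a b g 0] assms by (auto simp: mono_def)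

lemma polygon_lengths_mono:
  assumes "{a..b} \<subseteq> {c..d}" shows "polygon_lengths g a b \<subseteq> polygon_lengths g c d"
  using assms unfolding polygon_lengths_def by blast

text \<open>
  The segment from the last vertex of the first polygon to the first vertex of the second one is
  added, so the length of the joined polygon can exceed \<open>p + q\<close>.
\<close>
lemma polygon_lengths_join:
  assumes p: "p \<in> polygon_lengths g a b" and q: "q \<in> polygon_lengths g b c" and "a \<le> b" "b \<le> c"
  shows "\<exists>r\<in>polygon_lengths g a c. p + q \<le> r"
proof -
  obtain m t where t: "mono t" "range t \<subseteq> {a..b}" and p: "p = (\<Sum>i<m. dist (g (t i)) (g (t (Suc i))))"
    using p unfolding polygon_lengths_def by blast
  obtain n t' where t': "mono t'" "range t' \<subseteq> {b..c}" and q: "q = (\<Sum>i<n. dist (g (t' i)) (g (t' (Suc i))))"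
    using q unfolding polygon_lengths_def by blast
  define u where "u i = (if i \<le> m then t i else t' (i - Suc m))" for i
  let ?f = "\<lambda>i. dist (g (u i)) (g (u (Suc i)))"
  have ti: "a \<le> t i" "t i \<le> b" and ti': "b \<le> t' i" "t' i \<le> c" for i
    using t(2) t'(2) by (auto simp: image_subset_iff)
  have "mono u"
    using monoD[OF t(1)] monoD[OF t'(1)] order_trans[OF ti(2) ti'(1)] by (auto simp: mono_def u_def)
  moreover have "range u \<subseteq> {a..c}"
    using ti ti' order_trans[OF ti(2) \<open>b \<le> c\<close>] order_trans[OF \<open>a \<le> b\<close> ti'(1)] by (auto simp: u_def)
  ultimately have "(\<Sum>i<Suc m + n. ?f i) \<in> polygon_lengths g a c" by (rule polygon_lengthsI)
  moreover have "p + q \<le> (\<Sum>i<Suc m + n. ?f i)"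
  proof -
    have "p = (\<Sum>i<m. ?f i)" unfolding p by (rule sum.cong) (auto simp: u_def)
    moreover have "q = (\<Sum>i<n. ?f (Suc m + i))" unfolding q by (rule sum.cong) (auto simp: u_def)
    moreover have "(\<Sum>i<Suc m + n. ?f i) = (\<Sum>i<Suc m. ?f i) + (\<Sum>i<n. ?f (Suc m + i))"
      by (induction n) (simp_all add: algebra_simps)
    ultimately show ?thesis by simp
  qed
  ultimately show ?thesis by blast
qed

text \<open>
  Replacing the vertices \<open>t i\<close> by \<open>min (t i) b\<close> and by \<open>max (t i) b\<close> splits a polygon at the
  parameter \<open>b\<close>. Only the segment that crosses \<open>b\<close> is affected, and there the triangle
  inequality applies.
\<close>
lemma dist_sum_split_le:
  fixes g :: "real \<Rightarrow> 'a::metric_space"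
  assumes "mono t"
  shows "(\<Sum>i<m. dist (g (t i)) (g (t (Suc i)))) \<le>
    (\<Sum>i<m. dist (g (min (t i) b)) (g (min (t (Suc i)) b))) +
    (\<Sum>i<m. dist (g (max (t i) b)) (g (max (t (Suc i)) b)))"
  unfolding sum.distrib[symmetric]
proof (rule sum_mono)
  fix i
  have "t i \<le> t (Suc i)" using assms by (auto simp: mono_def)
  then show "dist (g (t i)) (g (t (Suc i))) \<le>
      dist (g (min (t i) b)) (g (min (t (Suc i)) b)) + dist (g (max (t i) b)) (g (max (t (Suc i)) b))"
    using dist_triangle[of "g (t i)" "g (t (Suc i))" "g b"] by (auto simp: min_def max_def)
qed

lemma curve_length_add:
  assumes bdd: "bdd_above (polygon_lengths g a c)" and "a \<le> b" "b \<le> c"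
  shows "curve_length g a c = curve_length g a b + curve_length g b c"
proof (rule antisym)
  have sub: "polygon_lengths g a b \<subseteq> polygon_lengths g a c" "polygon_lengths g b c \<subseteq> polygon_lengths g a c"
    using assms by (auto intro!: polygon_lengths_mono)
  have bdd1: "bdd_above (polygon_lengths g a b)" and bdd2: "bdd_above (polygon_lengths g b c)"
    using bdd_above_mono[OF bdd] sub by auto
  show "curve_length g a c \<le> curve_length g a b + curve_length g b c"
  proof (rule cSup_least)
    fix p assume "p \<in> polygon_lengths g a c"
    then obtain m t where t: "mono t" "range t \<subseteq> {a..c}" and p: "p = (\<Sum>i<m. dist (g (t i)) (g (t (Suc i))))"
      unfolding polygon_lengths_def by blast
    have "(\<Sum>i<m. dist (g (min (t i) b)) (g (min (t (Suc i)) b))) \<in> polygon_lengths g a b"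
    proof (rule polygon_lengthsI)
      show "mono (\<lambda>i. min (t i) b)" by (intro monoI min.mono monoD[OF t(1)] order_refl)
    qed (use t(2) \<open>a \<le> b\<close> in \<open>auto simp: image_subset_iff\<close>)
    moreover have "(\<Sum>i<m. dist (g (max (t i) b)) (g (max (t (Suc i)) b))) \<in> polygon_lengths g b c"
    proof (rule polygon_lengthsI)
      show "mono (\<lambda>i. max (t i) b)" by (intro monoI max.mono monoD[OF t(1)] order_refl)
    qed (use t(2) \<open>b \<le> c\<close> in \<open>auto simp: image_subset_iff\<close>)
    ultimately show "p \<le> curve_length g a b + curve_length g b c"
      unfolding p using dist_sum_split_le[OF t(1), of g m b] cSup_upper[OF _ bdd1] cSup_upper[OF _ bdd2]
      by (meson add_mono order_trans)
  qed (use assms in \<open>simp add: polygon_lengths_nonempty\<close>)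
  have "p + q \<le> curve_length g a c" if "p \<in> polygon_lengths g a b" "q \<in> polygon_lengths g b c" for p q
    using polygon_lengths_join[OF that \<open>a \<le> b\<close> \<open>b \<le> c\<close>] cSup_upper[OF _ bdd] by (meson order_trans)
  then have "p \<le> curve_length g a c - q" if "p \<in> polygon_lengths g a b" "q \<in> polygon_lengths g b c" for p q
    using that by (simp add: le_diff_eq)
  then have "curve_length g a b \<le> curve_length g a c - q" if "q \<in> polygon_lengths g b c" for q
    using that \<open>a \<le> b\<close> by (intro cSup_least polygon_lengths_nonempty)
  then have "q \<le> curve_length g a c - curve_length g a b" if "q \<in> polygon_lengths g b c" for q
    using that by fastforce
  then have "curve_length g b c \<le> curve_length g a c - curve_length g a b"
    using \<open>b \<le> c\<close> by (intro cSup_least polygon_lengths_nonempty)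
  then show "curve_length g a b + curve_length g b c \<le> curve_length g a c" by simp
qed

lemma dist_le_curve_length:
  assumes "bdd_above (polygon_lengths g a b)" "a \<le> b"
  shows "dist (g a) (g b) \<le> curve_length g a b"
proof -
  have "(\<Sum>i<1. dist (g (if i = 0 then a else b)) (g (if Suc i = 0 then a else b))) \<in> polygon_lengths g a b"
    using assms(2) by (intro polygon_lengthsI) (auto simp: mono_def)
  then show ?thesis using cSup_upper[OF _ assms(1)] by fastforce
qed

text \<open>
  The length is a supremum of the lengths of polygons. Truncating the vertices of a fixed
  polygon at \<open>x\<close> gives a polygon whose length depends continuously on \<open>x\<close>, so the length of
  the curve is lower semicontinuous in either end of the parameter interval.
\<close>
lemma eventually_less_curve_length:
  fixes g :: "real \<Rightarrow> 'a::metric_space"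
  assumes g: "continuous_on {a..b} g" and bdd: "bdd_above (polygon_lengths g a b)"
    and r: "r \<in> {a..b}"
  shows "e < curve_length g a r \<Longrightarrow> eventually (\<lambda>x. e < curve_length g a x) (at r within {a..b})"
    and "e < curve_length g r b \<Longrightarrow> eventually (\<lambda>x. e < curve_length g x b) (at r within {a..b})"
proof -
  assume "e < curve_length g a r"
  then obtain p where "p \<in> polygon_lengths g a r" "e < p"
    using less_cSupD[OF polygon_lengths_nonempty] r by (metis atLeastAtMost_iff)
  then obtain m t where t: "mono t" "range t \<subseteq> {a..r}" and e: "e < (\<Sum>i<m. dist (g (t i)) (g (t (Suc i))))"
    unfolding polygon_lengths_def by blast
  define P where "P x = (\<Sum>i<m. dist (g (min (t i) x)) (g (min (t (Suc i)) x)))" for x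
  have ti: "a \<le> t i" "t i \<le> r" "t i \<le> b" for i
    using t(2) r by (auto simp: image_subset_iff intro: order_trans)
  have "continuous_on {a..b} P"
    unfolding P_def using ti
    by (intro continuous_intros continuous_on_compose2[OF g]) (auto simp: min_le_iff_disj)
  then have "(P \<longlongrightarrow> P r) (at r within {a..b})"
    using r by (simp add: continuous_on_def)
  moreover have "e < P r" using e ti by (simp add: P_def min_absorb1)
  ultimately have "eventually (\<lambda>x. e < P x) (at r within {a..b})"
    by (auto dest: order_tendstoD(1))
  moreover have "eventually (\<lambda>x. x \<in> {a..b}) (at r within {a..b})"
    by (simp add: eventually_at_topological) blast
  ultimately show "eventually (\<lambda>x. e < curve_length g a x) (at r within {a..b})"
  proof eventually_elim
    case (elim x)
    have "P x \<in> polygon_lengths g a x"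
      unfolding P_def
    proof (rule polygon_lengthsI)
      show "mono (\<lambda>i. min (t i) x)" by (intro monoI min.mono monoD[OF t(1)] order_refl)
    qed (use ti elim in auto)
    moreover have "bdd_above (polygon_lengths g a x)"
      using bdd by (rule bdd_above_mono) (use elim in \<open>auto intro!: polygon_lengths_mono\<close>)
    ultimately show ?case using elim cSup_upper by fastforce
  qed
next
  assume "e < curve_length g r b"
  then obtain p where "p \<in> polygon_lengths g r b" "e < p"
    using less_cSupD[OF polygon_lengths_nonempty] r by (metis atLeastAtMost_iff)
  then obtain m t where t: "mono t" "range t \<subseteq> {r..b}" and e: "e < (\<Sum>i<m. dist (g (t i)) (g (t (Suc i))))"
    unfolding polygon_lengths_def by blast
  define P where "P x = (\<Sum>i<m. dist (g (max (t i) x)) (g (max (t (Suc i)) x)))" for x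
  have ti: "a \<le> t i" "r \<le> t i" "t i \<le> b" for i
    using t(2) r by (auto simp: image_subset_iff intro: order_trans)
  have "continuous_on {a..b} P"
    unfolding P_def using ti
    by (intro continuous_intros continuous_on_compose2[OF g]) (auto simp: le_max_iff_disj)
  then have "(P \<longlongrightarrow> P r) (at r within {a..b})"
    using r by (simp add: continuous_on_def)
  moreover have "e < P r" using e ti by (simp add: P_def max_absorb1)
  ultimately have "eventually (\<lambda>x. e < P x) (at r within {a..b})"
    by (auto dest: order_tendstoD(1))
  moreover have "eventually (\<lambda>x. x \<in> {a..b}) (at r within {a..b})"
    by (simp add: eventually_at_topological) blast
  ultimately show "eventually (\<lambda>x. e < curve_length g x b) (at r within {a..b})"
  proof eventually_elim
    case (elim x)
    have "P x \<in> polygon_lengths g x b"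
      unfolding P_def
    proof (rule polygon_lengthsI)
      show "mono (\<lambda>i. max (t i) x)" by (intro monoI max.mono monoD[OF t(1)] order_refl)
    qed (use ti elim in auto)
    moreover have "bdd_above (polygon_lengths g x b)"
      using bdd by (rule bdd_above_mono) (use elim in \<open>auto intro!: polygon_lengths_mono\<close>)
    ultimately show ?case using elim cSup_upper by fastforce
  qed
qed

text \<open>
  The lengths of the two parts of the curve before and after \<open>x\<close> are lower semicontinuous in \<open>x\<close>,
  and their sum is constant, so both are continuous.
\<close>
lemma continuous_on_curve_length:
  fixes g :: "real \<Rightarrow> 'a::metric_space"
  assumes g: "continuous_on {a..b} g" and bdd: "bdd_above (polygon_lengths g a b)"
  shows "continuous_on {a..b} (curve_length g a)"
  unfolding continuous_on_def
proof
  fix r assume r: "r \<in> {a..b}"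
  have add: "curve_length g a x + curve_length g x b = curve_length g a b" if "x \<in> {a..b}" for x
    using curve_length_add[OF bdd, of x] that by simp
  show "(curve_length g a \<longlongrightarrow> curve_length g a r) (at r within {a..b})"
  proof (rule order_tendstoI)
    fix e assume "e < curve_length g a r"
    then show "eventually (\<lambda>x. e < curve_length g a x) (at r within {a..b})"
      by (rule eventually_less_curve_length(1)[OF g bdd r])
  next
    fix e assume "curve_length g a r < e"
    then have "curve_length g a b - e < curve_length g r b" using add[OF r] by linarith
    then have "eventually (\<lambda>x. curve_length g a b - e < curve_length g x b) (at r within {a..b})"
      by (rule eventually_less_curve_length(2)[OF g bdd r])
    moreover have "eventually (\<lambda>x. x \<in> {a..b}) (at r within {a..b})"
      by (simp add: eventually_at_topological) blast
    ultimately show "eventually (\<lambda>x. curve_length g a x < e) (at r within {a..b})"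
    proof eventually_elim
      case (elim x)
      then show ?case using add[of x] by linarith
    qed
  qed
qed

text \<open>
  Continuity of the arc length yields a parameter for each \<open>\<sigma>\<close>, by the intermediate value
  theorem. The distance of two points of the curve is at most the length of the arc between them, which
  makes the parametrization 1-Lipschitz and independent of the choice of the parameter.
\<close>
lemma arc_length_param_properties:
  fixes g :: "real \<Rightarrow> 'a::metric_space"
  assumes "rectifiable_path g"
  shows lipschitz_arc_length_param: "1-lipschitz_on {0..arc_length g 1} (arc_length_param g)"
    and arc_length_param_image: "arc_length_param g ` {0..arc_length g 1} = path_image g"
proof -
  have g: "continuous_on {0..1} g" and bdd: "bdd_above (polygon_lengths g 0 1)"
    using assms by (auto simp: rectifiable_path_def path_def)
  have A: "arc_length g = curve_length g 0" by (simp add: arc_length_def fun_eq_iff)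
  have lip: "dist (g t) (g t') \<le> arc_length g t' - arc_length g t" if "0 \<le> t" "t \<le> t'" "t' \<le> 1" for t t'
  proof -
    have sub: "polygon_lengths g t t' \<subseteq> polygon_lengths g 0 1" "polygon_lengths g 0 t' \<subseteq> polygon_lengths g 0 1"
      using that by (auto intro!: polygon_lengths_mono)
    have "arc_length g t' = arc_length g t + curve_length g t t'"
      unfolding A using that bdd_above_mono[OF bdd sub(2)] by (intro curve_length_add)
    moreover have "dist (g t) (g t') \<le> curve_length g t t'"
      using that bdd_above_mono[OF bdd sub(1)] by (intro dist_le_curve_length)
    ultimately show ?thesis by linarith
  qed
  have lip': "dist (g t) (g t') \<le> \<bar>arc_length g t - arc_length g t'\<bar>" if "t \<in> {0..1}" "t' \<in> {0..1}" for t t'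
    using lip[of t t'] lip[of t' t] that by (cases "t \<le> t'") (auto simp: dist_commute)
  have A0: "arc_length g 0 = 0"
    using curve_length_add[OF bdd, of 0] by (simp add: A)
  have A_range: "arc_length g t \<in> {0..arc_length g 1}" if "t \<in> {0..1}" for t
  proof -
    have "0 \<le> arc_length g t - arc_length g 0" "0 \<le> arc_length g 1 - arc_length g t"
      using that by (auto intro!: order_trans[OF zero_le_dist lip] simp del: diff_ge_0_iff_ge)
    then show ?thesis using A0 by simp
  qed
  have "\<exists>t. t \<in> {0..1} \<and> arc_length g t = \<sigma>" if "\<sigma> \<in> {0..arc_length g 1}" for \<sigma>
    using IVT'[of "arc_length g" 0 \<sigma> 1] continuous_on_curve_length[OF g bdd] that A0 by (auto simp: A)
  then have "\<exists>t. t \<in> {0..1} \<and> arc_length g t = \<sigma> \<and> arc_length_param g \<sigma> = g t"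
    if "\<sigma> \<in> {0..arc_length g 1}" for \<sigma>
    using someI_ex[of "\<lambda>t. t \<in> {0..1} \<and> arc_length g t = \<sigma>"] that unfolding arc_length_param_def by blast
  then obtain \<theta> where \<theta>: "\<And>\<sigma>. \<sigma> \<in> {0..arc_length g 1} \<Longrightarrow>
      \<theta> \<sigma> \<in> {0..1} \<and> arc_length g (\<theta> \<sigma>) = \<sigma> \<and> arc_length_param g \<sigma> = g (\<theta> \<sigma>)"
    by metis
  show "1-lipschitz_on {0..arc_length g 1} (arc_length_param g)"
  proof (rule lipschitz_onI)
    show "dist (arc_length_param g \<sigma>) (arc_length_param g \<tau>) \<le> 1 * dist \<sigma> \<tau>"
      if "\<sigma> \<in> {0..arc_length g 1}" "\<tau> \<in> {0..arc_length g 1}" for \<sigma> \<tau>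
      using lip'[of "\<theta> \<sigma>" "\<theta> \<tau>"] \<theta>[OF that(1)] \<theta>[OF that(2)] by (simp add: dist_real_def)
  qed simp
  show "arc_length_param g ` {0..arc_length g 1} = path_image g"
  proof
    show "arc_length_param g ` {0..arc_length g 1} \<subseteq> path_image g"
      using \<theta> by (auto simp: path_image_def)
    show "path_image g \<subseteq> arc_length_param g ` {0..arc_length g 1}"
    proof
      fix p assume "p \<in> path_image g"
      then obtain t where t: "t \<in> {0..1}" "p = g t" by (auto simp: path_image_def)
      have "dist (g (\<theta> (arc_length g t))) (g t) \<le> 0"
        using lip'[OF _ t(1)] \<theta>[OF A_range[OF t(1)]] by fastforce
      then have "arc_length_param g (arc_length g t) = p"
        using \<theta>[OF A_range[OF t(1)]] t(2) by simp
      then show "p \<in> arc_length_param g ` {0..arc_length g 1}" using A_range[OF t(1)] by blast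
    qed
  qed
qed

lemma rectifiable_path_if_lipschitz:
  assumes "B-lipschitz_on {0..1} g"
  shows "rectifiable_path g"
proof -
  have "p \<le> B" if p: "p \<in> polygon_lengths g 0 1" for p
  proof -
    obtain m t where t: "mono t" "range t \<subseteq> {0..1}" and p: "p = (\<Sum>i<m. dist (g (t i)) (g (t (Suc i))))"
      using p unfolding polygon_lengths_def by blast
    have B: "0 \<le> B" using assms by (rule lipschitz_on_nonneg)
    have "p \<le> (\<Sum>i<m. B * (t (Suc i) - t i))"
      unfolding p
    proof (rule sum_mono)
      fix i
      have "t i \<le> t (Suc i)" using t(1) by (auto simp: mono_def)
      moreover have "t i \<in> {0..1}" "t (Suc i) \<in> {0..1}" using t(2) by blast+
      ultimately show "dist (g (t i)) (g (t (Suc i))) \<le> B * (t (Suc i) - t i)"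
        using lipschitz_onD[OF assms, of "t i" "t (Suc i)"] by (simp add: dist_real_def)
    qed
    also have "\<dots> = B * (t m - t 0)"
      by (simp add: sum_distrib_left[symmetric] sum_lessThan_telescope)
    also have "\<dots> \<le> B * 1"
    proof (intro mult_left_mono B)
      have "t m \<le> 1" "0 \<le> t 0" using t(2) by (auto simp: image_subset_iff)
      then show "t m - t 0 \<le> 1" by simp
    qed
    finally show ?thesis by simp
  qed
  then show ?thesis
    using lipschitz_on_continuous_on[OF assms] by (auto simp: rectifiable_path_def path_def bdd_above_def)
qed

text \<open>
  Points of a connected open set can be joined by a polynomial path, whose derivative is bounded.
\<close>
lemma exists_rectifiable_path:
  fixes x y :: "'a::euclidean_space"
  assumes "open G" "connected G" "x \<in> G" "y \<in> G"
  obtains g where "rectifiable_path g" "path_image g \<subseteq> G" "x \<in> path_image g" "y \<in> path_image g"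
proof -
  obtain g where g: "polynomial_function g" "path_image g \<subseteq> G" "pathstart g = x" "pathfinish g = y"
    using connected_open_polynomial_connected[OF assms] by blast
  obtain g' where g': "polynomial_function g'" "\<And>t. (g has_vector_derivative g' t) (at t)"
    using has_vector_derivative_polynomial_function[OF g(1)] by blast
  have "compact (g' ` {0..1})"
    using g'(1) by (intro compact_continuous_image continuous_on_polymonial_function) auto
  then obtain B where B: "\<And>t. t \<in> {0..1} \<Longrightarrow> norm (g' t) \<le> B" "0 < B"
    using compact_imp_bounded[of "g' ` {0..1}"] unfolding bounded_pos by blast
  have "B-lipschitz_on {0..1} g"
  proof (rule lipschitz_onI)
    fix t u :: real assume "t \<in> {0..1}" "u \<in> {0..1}"
    then have "norm (g t - g u) \<le> B * norm (t - u)"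
    proof (intro differentiable_bound[of "{0..1}" g "\<lambda>t h. h *\<^sub>R g' t" B])
      show "(g has_derivative (\<lambda>h. h *\<^sub>R g' t)) (at t within {0..1})" for t
        using g'(2)[of t] by (auto simp: has_vector_derivative_def intro: has_derivative_at_withinI)
      show "onorm (\<lambda>h. h *\<^sub>R g' t) \<le> B" if "t \<in> {0..1}" for t
        using B(1)[OF that] B(2) by (intro onorm_bound) (simp_all add: mult.commute[of B] mult_left_mono)
    qed auto
    then show "dist (g t) (g u) \<le> B * dist t u" by (simp add: dist_norm)
  qed (use B in simp)
  then show thesis
    using that[OF rectifiable_path_if_lipschitz] g pathstart_in_path_image[of g] pathfinish_in_path_image[of g] by blast
qed

section \<open>Quasihyperbolic length\<close>

text \<open>
  A ball is connected, so if it left \<open>G\<close> it would meet the frontier at a distance less than its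
  radius.
\<close>
lemma ball_infdist_frontier_subset:
  fixes G :: "'a::real_normed_vector set"
  assumes "z \<in> G"
  shows "ball z (infdist z (frontier G)) \<subseteq> G"
proof
  fix p assume p: "p \<in> ball z (infdist z (frontier G))"
  show "p \<in> G"
  proof (rule ccontr)
    assume "p \<notin> G"
    let ?B = "ball z (infdist z (frontier G))"
    have "z \<in> ?B" using p by (simp add: le_less_trans[OF zero_le_dist])
    then obtain f where "f \<in> ?B" "f \<in> frontier G"
      using connected_Int_frontier[of ?B G] \<open>z \<in> G\<close> \<open>p \<notin> G\<close> p by blast
    then show False using infdist_le[of f "frontier G" z] by (simp add: dist_commute)
  qed
qed

lemma infdist_frontier_pos:
  fixes G :: "'a::real_normed_vector set"
  assumes "open G" "G \<noteq> UNIV" "z \<in> G"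
  shows "0 < infdist z (frontier G)"
proof -
  have "frontier G \<noteq> {}" using assms frontier_eq_empty by blast
  moreover have "z \<notin> frontier G" using assms by (simp add: frontier_def interior_open)
  ultimately have "infdist z (frontier G) \<noteq> 0"
    using in_closed_iff_infdist_zero[of "frontier G" z] by simp
  then show ?thesis using infdist_nonneg[of z "frontier G"] by linarith
qed

text \<open>
  By the bound on the growth of \<open>D\<close>, the integral is at least that of \<open>1 / (D a + (t - a))\<close>, which is
  \<open>ln (1 + (b - a) / D a)\<close>.
\<close>
lemma interval_length_le_of_integral_le_left:
  fixes D :: "real \<Rightarrow> real"
  assumes "a \<le> b" and cont: "continuous_on {a..b} D" and pos: "\<And>t. t \<in> {a..b} \<Longrightarrow> 0 < D t"
    and growth: "\<And>t. t \<in> {a..b} \<Longrightarrow> D t \<le> D a + (t - a)"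
    and "0 \<le> s" and int: "integral {a..b} (\<lambda>t. 1 / D t) \<le> ln (1 + s)"
  shows "b - a \<le> s * D a"
proof -
  have Da: "0 < D a" using pos[of a] \<open>a \<le> b\<close> by simp
  have upper: "((\<lambda>t. 1 / (D a + (t - a))) has_integral ln (D a + (b - a)) - ln (D a + (a - a))) {a..b}"
    using \<open>a \<le> b\<close> Da
    by (intro fundamental_theorem_of_calculus)
       (auto intro!: derivative_eq_intros simp flip: has_real_derivative_iff_has_vector_derivative)
  have lower: "((\<lambda>t. 1 / D t) has_integral integral {a..b} (\<lambda>t. 1 / D t)) {a..b}"
    using cont pos by (intro integrable_integral integrable_continuous_interval continuous_intros) fastforce+
  have "ln (D a + (b - a)) - ln (D a + (a - a)) \<le> integral {a..b} (\<lambda>t. 1 / D t)"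
  proof (rule has_integral_le[OF upper lower])
    show "1 / (D a + (t - a)) \<le> 1 / D t" if "t \<in> {a..b}" for t
      using pos[OF that] growth[OF that] by (simp add: frac_le)
  qed
  then have "ln (D a + (b - a)) \<le> ln (1 + s) + ln (D a)" using int by simp
  also have "\<dots> = ln ((1 + s) * D a)" using \<open>0 \<le> s\<close> Da by (simp add: ln_mult)
  finally have "D a + (b - a) \<le> (1 + s) * D a" using Da \<open>0 \<le> s\<close> \<open>a \<le> b\<close> by (simp add: add_pos_nonneg)
  then show ?thesis by (simp add: algebra_simps)
qed

text \<open>
  The reflection of the previous estimate, for arcs that end at the midpoint.
\<close>
lemma interval_length_le_of_integral_le_right:
  fixes D :: "real \<Rightarrow> real"
  assumes "a \<le> b" and cont: "continuous_on {a..b} D" and pos: "\<And>t. t \<in> {a..b} \<Longrightarrow> 0 < D t"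
    and growth: "\<And>t. t \<in> {a..b} \<Longrightarrow> D t \<le> D b + (b - t)"
    and "0 \<le> s" and int: "integral {a..b} (\<lambda>t. 1 / D t) \<le> ln (1 + s)"
  shows "b - a \<le> s * D b"
proof -
  have "(- a) - (- b) \<le> s * D (- (- b))"
  proof (rule interval_length_le_of_integral_le_left)
    show "continuous_on {- b..- a} (\<lambda>t. D (- t))"
      by (rule continuous_on_compose2[OF cont]) (auto intro!: continuous_intros)
    show "integral {- b..- a} (\<lambda>t. 1 / D (- t)) \<le> ln (1 + s)"
      using int Henstock_Kurzweil_Integration.integral_reflect_real[where f = "\<lambda>t. 1 / D t"] by simp
    show "D (- t) \<le> D (- (- b)) + (t - - b)" if "t \<in> {- b..- a}" for t
      using growth[of "- t"] that by auto
  qed (use assms in auto)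
  then show ?thesis by simp
qed

text \<open>
  The curve is reparametrized by its quasihyperbolic length, measured from \<open>a\<close> by the function \<open>K\<close>.
  Points at distance at most \<open>2 * ln (1 + s)\<close> along the curve are joined through the point that
  halves the quasihyperbolic length of the arc between them.
\<close>
lemma harnack_chain_of_curve:
  fixes h :: "real \<Rightarrow> real^'n::finite"
  assumes "0 < s" and G: "open G" "G \<noteq> UNIV" and "a \<le> b"
    and h: "1-lipschitz_on {a..b} h" and hG: "h ` {a..b} \<subseteq> G"
  shows "harnack_chain s G (2 * ln (1 + s)) (integral {a..b} (\<lambda>t. 1 / infdist (h t) (frontier G))) (h a) (h b)"
proof -
  define D where "D t = infdist (h t) (frontier G)" for t
  define K where "K t = integral {a..t} (\<lambda>t. 1 / D t)" for t
  have pos: "0 < D t" if "t \<in> {a..b}" for t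
    unfolding D_def by (rule infdist_frontier_pos[OF G]) (use hG that in blast)
  have D_lip: "D t \<le> D u + \<bar>t - u\<bar>" if "t \<in> {a..b}" "u \<in> {a..b}" for t u
    using infdist_triangle[of "h t" "frontier G" "h u"] lipschitz_onD[OF h that]
    by (simp add: D_def dist_real_def)
  have "continuous_on {a..b} h" using h by (rule lipschitz_on_continuous_on)
  then have D_cont: "continuous_on {a..b} D" unfolding D_def by (intro continuous_intros)
  have "continuous_on {a..b} (\<lambda>t. 1 / D t)"
    using D_cont pos by (intro continuous_intros) fastforce+
  then have int: "(\<lambda>t. 1 / D t) integrable_on {a..b}" by (rule integrable_continuous_interval)
  have K_cont: "continuous_on {a..b} K"
    unfolding K_def by (rule indefinite_integral_continuous_1[OF int])
  have K_diff: "K v - K u = integral {u..v} (\<lambda>t. 1 / D t)" if "a \<le> u" "u \<le> v" "v \<le> b" for u v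
  proof -
    have "(\<lambda>t. 1 / D t) integrable_on {a..v}"
      using int by (rule integrable_on_subinterval) (use that in auto)
    then show ?thesis
      using Henstock_Kurzweil_Integration.integral_combine[of a u v "\<lambda>t. 1 / D t"] that by (simp add: K_def)
  qed
  have short1: "v - u \<le> r * D u" and short2: "v - u \<le> r * D v"
    if "a \<le> u" "u \<le> v" "v \<le> b" "0 \<le> r" "K v - K u \<le> ln (1 + r)" for u v r
  proof -
    have cont': "continuous_on {u..v} D"
      using D_cont by (rule continuous_on_subset) (use that in auto)
    show "v - u \<le> r * D u"
    proof (rule interval_length_le_of_integral_le_left)
      show "D t \<le> D u + (t - u)" if "t \<in> {u..v}" for t
        using D_lip[of t u] that \<open>a \<le> u\<close> \<open>u \<le> v\<close> \<open>v \<le> b\<close> by auto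
    qed (use that cont' pos K_diff[of u v] in auto)
    show "v - u \<le> r * D v"
    proof (rule interval_length_le_of_integral_le_right)
      show "D t \<le> D v + (v - t)" if "t \<in> {u..v}" for t
        using D_lip[of t v] that \<open>a \<le> u\<close> \<open>u \<le> v\<close> \<open>v \<le> b\<close> by auto
    qed (use that cont' pos K_diff[of u v] in auto)
  qed
  have K_mono: "K u \<le> K v" if uv: "a \<le> u" "u \<le> v" "v \<le> b" for u v
  proof -
    have "0 \<le> integral {u..v} (\<lambda>t. 1 / D t)"
    proof (rule integral_nonneg)
      show "(\<lambda>t. 1 / D t) integrable_on {u..v}"
        using int by (rule integrable_on_subinterval) (use uv in auto)
    qed (use pos uv in \<open>auto intro!: less_imp_le\<close>)
    then show ?thesis using K_diff[OF uv] by simp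
  qed
  have linked: "harnack_linked s G (h u) (h v)"
    if uv: "a \<le> u" "u \<le> v" "v \<le> b" and K: "\<bar>K v - K u\<bar> \<le> 2 * ln (1 + s)" for u v
  proof -
    have "K u \<le> (K u + K v) / 2" "(K u + K v) / 2 \<le> K v" using K_mono[OF uv] by auto
    moreover have "continuous_on {u..v} K"
      using K_cont by (rule continuous_on_subset) (use uv in auto)
    ultimately obtain m where m: "u \<le> m" "m \<le> v" "K m = (K u + K v) / 2"
      using IVT'[of K u "(K u + K v) / 2" v] uv by blast
    have "m - u \<le> s * D m" "v - m \<le> s * D m"
      using short2[of u m s] short1[of m v s] uv m K \<open>0 < s\<close> by (auto simp: field_simps)
    moreover have "dist (h m) (h u) \<le> m - u" "dist (h m) (h v) \<le> v - m"
      using lipschitz_onD[OF h, of m u] lipschitz_onD[OF h, of m v] uv m by (auto simp: dist_real_def)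
    ultimately have "h u \<in> cball (h m) (s * D m)" "h v \<in> cball (h m) (s * D m)" by auto
    moreover have "ball (h m) (D m) \<subseteq> G"
      unfolding D_def using hG uv m by (intro ball_infdist_frontier_subset) auto
    moreover have "0 < D m" using pos uv m by auto
    ultimately show ?thesis unfolding harnack_linked_def by blast
  qed
  have "K a = 0" by (simp add: K_def)
  have "\<exists>u. 0 \<le> t \<longrightarrow> t \<le> K b \<longrightarrow> u \<in> {a..b} \<and> K u = t \<and> (t = 0 \<longrightarrow> u = a) \<and> (t = K b \<longrightarrow> u = b)" for t
  proof (cases "t = 0 \<or> t = K b")
    case True
    \<comment> \<open>The required values at the ends are compatible if \<open>K b = 0\<close>: then the interval is a point.\<close>
    have "a = b" if "K b = 0"
      using short1[of a b 0] that \<open>K a = 0\<close> \<open>a \<le> b\<close> by simp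
    then show ?thesis using True \<open>K a = 0\<close> \<open>a \<le> b\<close> by (cases "t = 0") auto
  next
    case False
    then show ?thesis using IVT'[of K a t b] \<open>K a = 0\<close> K_cont \<open>a \<le> b\<close> by auto
  qed
  then obtain \<theta> where \<theta>: "\<And>t. 0 \<le> t \<Longrightarrow> t \<le> K b \<Longrightarrow>
      \<theta> t \<in> {a..b} \<and> K (\<theta> t) = t \<and> (t = 0 \<longrightarrow> \<theta> t = a) \<and> (t = K b \<longrightarrow> \<theta> t = b)"
    by metis
  have "0 \<le> K b" using K_mono[of a b] \<open>K a = 0\<close> \<open>a \<le> b\<close> by simp
  have "harnack_linked s G (h (\<theta> t)) (h (\<theta> t'))"
    if "0 \<le> t" "t \<le> t'" "t' \<le> K b" "t' - t \<le> 2 * ln (1 + s)" for t t'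
  proof (cases "\<theta> t \<le> \<theta> t'")
    case True
    then show ?thesis using linked[of "\<theta> t" "\<theta> t'"] \<theta>[of t] \<theta>[of t'] that by auto
  next
    case False
    then have "harnack_linked s G (h (\<theta> t')) (h (\<theta> t))"
      using linked[of "\<theta> t'" "\<theta> t"] \<theta>[of t] \<theta>[of t'] that by auto
    then show ?thesis by (rule harnack_linked_commute[THEN iffD1])
  qed
  moreover have "h (\<theta> 0) = h a" "h (\<theta> (K b)) = h b" using \<theta>[of 0] \<theta>[of "K b"] \<open>0 \<le> K b\<close> by auto
  ultimately have "harnack_chain s G (2 * ln (1 + s)) (K b) (h a) (h b)"
    unfolding harnack_chain_def by (intro exI[of _ "h \<circ> \<theta>"]) auto
  then show ?thesis by (simp add: K_def D_def)
qed

text \<open>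
  The bound is affine in \<open>I\<close> with slope \<open>d / l\<close>. If \<open>d = 0\<close>, one element of \<open>S\<close> is enough;
  otherwise the inequality can be solved for \<open>I\<close>.
\<close>
lemma le_affine_Inf:
  fixes S :: "real set"
  assumes "S \<noteq> {}" "0 < l" "0 \<le> d" and le: "\<And>I. I \<in> S \<Longrightarrow> v \<le> (1 + I / l) * d"
  shows "v \<le> (1 + Inf S / l) * d"
proof (cases "d = 0")
  case True
  then show ?thesis using le \<open>S \<noteq> {}\<close> by auto
next
  case False
  then have "0 < d" using \<open>0 \<le> d\<close> by simp
  have "(v / d - 1) * l \<le> Inf S"
  proof (rule cInf_greatest[OF \<open>S \<noteq> {}\<close>])
    fix I assume "I \<in> S"
    then have "v / d \<le> 1 + I / l" using le \<open>0 < d\<close> by (simp only: pos_divide_le_eq)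
    then have "v / d - 1 \<le> I / l" by simp
    then show "(v / d - 1) * l \<le> I" using \<open>0 < l\<close> by (simp only: pos_le_divide_eq)
  qed
  then have "v / d - 1 \<le> Inf S / l" using \<open>0 < l\<close> by (simp only: pos_le_divide_eq)
  then have "v / d \<le> 1 + Inf S / l" by simp
  then show ?thesis using \<open>0 < d\<close> by (simp only: pos_divide_le_eq)
qed

text \<open>
  A curve containing \<open>x\<close> and \<open>y\<close> has a subarc from one of them to the other, whose
  quasihyperbolic length is at most that of the curve. A chain along a subarc from \<open>y\<close> to \<open>x\<close> is reversed.
\<close>
lemma harnack_metric_le_quasihyperbolic:
  fixes G :: "(real^'n::finite) set"
  assumes s: "0 < s" "s < 1" and c: "1 \<le> c" and G: "open G" "connected G" "G \<noteq> UNIV"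
    and H: "\<And>u. u \<in> positive_harmonic G \<Longrightarrow> harnack_inequality s c G u"
    and x: "x \<in> G" and y: "y \<in> G"
  shows "harnack_metric G x y \<le> ereal ((1 + quasihyperbolic_metric G x y / (2 * ln (1 + s))) * ln c)"
proof -
  let ?l = "2 * ln (1 + s)"
  let ?\<rho> = "\<lambda>z. 1 / infdist z (frontier G)"
  let ?S = "{curve_integral ?\<rho> g | g.
    rectifiable_path g \<and> path_image g \<subseteq> G \<and> x \<in> path_image g \<and> y \<in> path_image g}"
  have l: "0 < ?l" and lnc: "0 \<le> ln c" using s c by auto
  have curve: "harnack_metric G x y \<le> ereal ((1 + I / ?l) * ln c)" if I_mem: "I \<in> ?S" for I
  proof -
    obtain g where I: "I = curve_integral ?\<rho> g" and g: "rectifiable_path g" "path_image g \<subseteq> G"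
      "x \<in> path_image g" "y \<in> path_image g"
      using I_mem by blast
    define h where "h = arc_length_param g"
    define L where "L = arc_length g 1"
    have h: "1-lipschitz_on {0..L} h" and h_image: "h ` {0..L} = path_image g"
      unfolding h_def L_def using g(1) by (rule lipschitz_arc_length_param arc_length_param_image)+
    have rho_nonneg: "0 \<le> ?\<rho> z" for z by (simp add: infdist_nonneg)
    have "continuous_on {0..L} (\<lambda>t. ?\<rho> (h t))"
    proof (intro continuous_intros lipschitz_on_continuous_on[OF h] ballI)
      fix t assume "t \<in> {0..L}"
      then have "h t \<in> G" using h_image g(2) by blast
      then show "infdist (h t) (frontier G) \<noteq> 0" using infdist_frontier_pos[OF G(1,3)] by fastforce
    qed
    then have int: "(\<lambda>t. ?\<rho> (h t)) integrable_on {0..L}" by (rule integrable_continuous_interval)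
    have piece: "\<exists>T\<le>I. 0 \<le> T \<and> harnack_chain s G ?l T (h a) (h b)" if "0 \<le> a" "a \<le> b" "b \<le> L" for a b
    proof (intro exI conjI)
      have sub: "{a..b} \<subseteq> {0..L}" using that by auto
      have int': "(\<lambda>t. ?\<rho> (h t)) integrable_on {a..b}"
        using int sub by (rule integrable_on_subinterval)
      then show "integral {a..b} (\<lambda>t. ?\<rho> (h t)) \<le> I"
        unfolding I curve_integral_def L_def[symmetric] h_def[symmetric]
        using int sub rho_nonneg by (intro integral_subset_le) auto
      show "0 \<le> integral {a..b} (\<lambda>t. ?\<rho> (h t))" using int' rho_nonneg by (rule integral_nonneg)
      show "harnack_chain s G ?l (integral {a..b} (\<lambda>t. ?\<rho> (h t))) (h a) (h b)"
        using s G that h_image g(2) sub lipschitz_on_subset[OF h sub]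
        by (intro harnack_chain_of_curve) auto
    qed
    obtain a b where ab: "a \<in> {0..L}" "b \<in> {0..L}" "h a = x" "h b = y"
      using g(3,4) h_image by (metis imageE)
    have "\<exists>T\<le>I. 0 \<le> T \<and> harnack_chain s G ?l T x y"
    proof (cases "a \<le> b")
      case True
      then show ?thesis using piece[of a b] ab by auto
    next
      case False
      then show ?thesis using piece[of b a] ab harnack_chain_commute[of s G ?l _ y x] by auto
    qed
    then obtain T where T: "T \<le> I" "0 \<le> T" "harnack_chain s G ?l T x y" by blast
    have "harnack_metric G x y \<le> ereal ((1 + T / ?l) * ln c)"
      using s c l T(2) x y H T(3) by (rule harnack_metric_le_of_chain)
    also have "\<dots> \<le> ereal ((1 + I / ?l) * ln c)"
      using T(1) l lnc by (auto intro!: mult_right_mono divide_right_mono)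
    finally show ?thesis .
  qed
  obtain g where "rectifiable_path g" "path_image g \<subseteq> G" "x \<in> path_image g" "y \<in> path_image g"
    using exists_rectifiable_path[OF G(1,2) x y] by metis
  then have "curve_integral ?\<rho> g \<in> ?S" by blast
  then have "?S \<noteq> {}" by auto
  show ?thesis
    unfolding harnack_metric_def quasihyperbolic_metric_def
  proof (rule SUP_least)
    fix u assume u: "u \<in> positive_harmonic G"
    have "\<bar>ln (u x / u y)\<bar> \<le> (1 + Inf ?S / ?l) * ln c"
      using \<open>?S \<noteq> {}\<close> l lnc
    proof (rule le_affine_Inf)
      fix I assume "I \<in> ?S"
      then show "\<bar>ln (u x / u y)\<bar> \<le> (1 + I / ?l) * ln c"
        using order_trans[OF SUP_upper[OF u] curve[unfolded harnack_metric_def]] by simp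
    qed
    then show "ereal \<bar>ln (u x / u y)\<bar> \<le> ereal ((1 + Inf ?S / ?l) * ln c)" by simp
  qed
qed

section \<open>The two estimates\<close>

theorem theorem3p3:
  fixes G :: "(real^'n) set" and s :: real and C :: "real \<Rightarrow> real"
  assumes "CARD('n) \<ge> 2"
    and "0 < s" and "s < 1" and "C s \<ge> 1"
    and "open G" and "connected G" and "G \<noteq> {}" and "G \<noteq> UNIV"
    and "\<And>u. u \<in> positive_harmonic G \<Longrightarrow> harnack_inequality s (C s) G u"
  shows
    "(\<forall>x\<in>G. \<forall>y\<in>G. harnack_metric G x y
        \<le> ereal ((1 + quasihyperbolic_metric G x y / (2 * ln (1 + s))) * ln (C s))) \<and>
     (G = ball 0 1 \<longrightarrow> (\<forall>x\<in>G. \<forall>y\<in>G. harnack_metric G x y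
        \<le> ereal ((1 + hyp_ball x y / ln ((1 + s) / (1 - s))) * ln (C s)))) \<and>
     (\<forall>k. G = half_space k \<longrightarrow> (\<forall>x\<in>G. \<forall>y\<in>G. harnack_metric G x y
        \<le> ereal ((1 + hyp_half_space k x y / ln ((1 + s) / (1 - s))) * ln (C s))))"
proof (intro conjI ballI impI allI)
  have l: "0 < ln ((1 + s) / (1 - s))" using harnack_radius(1)[OF assms(2,3)] by simp
  fix x y assume x: "x \<in> G" and y: "y \<in> G"
  show "harnack_metric G x y
      \<le> ereal ((1 + quasihyperbolic_metric G x y / (2 * ln (1 + s))) * ln (C s))"
    using assms x y by (intro harnack_metric_le_quasihyperbolic)
  have chain: "harnack_metric G x y \<le> ereal ((1 + T / ln ((1 + s) / (1 - s))) * ln (C s))"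
    if "0 \<le> T" "harnack_chain s G (ln ((1 + s) / (1 - s))) T x y" for T
    using assms(2-4) l that(1) x y assms(9) that(2) by (rule harnack_metric_le_of_chain)
  show "harnack_metric G x y \<le> ereal ((1 + hyp_ball x y / ln ((1 + s) / (1 - s))) * ln (C s))"
    if "G = ball 0 1"
    using chain sinh_hyp_ball(2) harnack_chain_ball[OF assms(2,3)] x y unfolding that by blast
  show "harnack_metric G x y
      \<le> ereal ((1 + hyp_half_space k x y / ln ((1 + s) / (1 - s))) * ln (C s))"
    if "G = half_space k" for k
    using chain cosh_hyp_half_space(2) harnack_chain_half_space[OF assms(2,3)] x y unfolding that by blast
qed

end
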